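(* For every matroid $M$ with a basis $B_0$, $$h(M;t)=\sum_{\tau}t^{|b_\tau|}\,h(K_\tau;t)\,E_\tau(t),$$ where the sum runs over $\tau=\emptyset$ and all dead strata $\tau$.
   Context: $M$ is a matroid on a finite ground set $E$ with fixed basis $B_0$; $R=E\setminus B_0$. For $i\in R$, $C_i$ is the fundamental circuit of $i$, the unique circuit contained in $B_0\cup\{i\}$. For $\sigma\subseteq R$ and $e\in E$ put $m_\sigma(e)=\#\{i\in\sigma: e\in C_i\}$, $U_\sigma=\{e: m_\sigma(e)=1\}$, $A_\sigma=\{e: m_\sigma(e)\ge1\}$. A stratum is a nonempty subset $\sigma\subseteq R$. It is dead if $U_\sigma$ is independent in $M$, and live otherwise. The baseline $b_\sigma\in\mathbb N^\sigma$ is $b_\sigma(i)=|C_i\cap U_\sigma|$, and $|b_\sigma|=\sum_{i\in\sigma}b_\sigma(i)$. A stratum $\sigma$ can be fired from $a\in\mathbb N^R$ if $a_i\ge b_\sigma(i)$ for all $i\in\sigma$. For a dead stratum $\sigma$ the dead node is the matroid $K_\sigma=(M|A_\sigma)/U_\sigma$. Conventions: $b_\emptyset=0$, $|b_\emptyset|=0$ and $h(K_\emptyset;t)=1$. For $\tau\subseteq R$ (possibly empty) the extension set $\mathrm{Ext}(\tau)$ is the set of $c\in\mathbb N^{R\setminus\tau}$ such that no stratum strictly containing $\tau$ can be fired from the vector $(b_\tau,c)\in\mathbb N^R$ that agrees with $b_\tau$ on $\tau$ and with $c$ on $R\setminus\tau$. Its generating function is $E_\tau(t)=\sum_{c\in\mathrm{Ext}(\tau)}t^{|c|}$,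 $|c|=\sum_i c_i$ (a polynomial, as $\mathrm{Ext}(\tau)$ is finite). For a matroid $N$ of rank $d$, $h(N;t)=\sum_{k=0}^d h_kt^k$, where $(h_0,\dots,h_d)$ is the $h$-vector of the independence complex of $N$, determined by $T_N(x,1)=\sum_k h_kx^{d-k}$ with $T_N$ the Tutte polynomial. *)

theory Defs
  imports "HOL-Computational_Algebra.Polynomial" "HOL-Library.FuncSet"
begin

section \<open>Matroids\<close>

record 'a set_system =
  ground :: "'a set"
  indeps :: "'a set set"

locale matroid =
  fixes M :: "'a set_system"
  assumes finite_ground: "finite (ground M)"
    and indeps_subset_ground: "I \<in> indeps M \<Longrightarrow> I \<subseteq> ground M"
    and empty_indep: "{} \<in> indeps M"
    and indeps_down_closed: "I \<in> indeps M \<Longrightarrow> J \<subseteq> I \<Longrightarrow> J \<in> indeps M"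
    and exchange: "I \<in> indeps M \<Longrightarrow> J \<in> indeps M \<Longrightarrow> card I < card J \<Longrightarrow>
      \<exists>e \<in> J - I. insert e I \<in> indeps M"

definition basis_of :: "'a set_system \<Rightarrow> 'a set \<Rightarrow> 'a set \<Rightarrow> bool" where
  "basis_of M X B \<longleftrightarrow>
     B \<in> indeps M \<and> B \<subseteq> X \<and> (\<forall>B' \<in> indeps M. B \<subseteq> B' \<and> B' \<subseteq> X \<longrightarrow> B' = B)"

definition basis :: "'a set_system \<Rightarrow> 'a set \<Rightarrow> bool" where
  "basis M B \<longleftrightarrow> basis_of M (ground M) B"

definition rank_of :: "'a set_system \<Rightarrow> 'a set \<Rightarrow> nat" where
  "rank_of M X = Max (card ` {I \<in> indeps M. I \<subseteq> X})"

definition rank :: "'a set_system \<Rightarrow> nat" where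
  "rank M = rank_of M (ground M)"

definition circuit :: "'a set_system \<Rightarrow> 'a set \<Rightarrow> bool" where
  "circuit M C \<longleftrightarrow> C \<subseteq> ground M \<and> C \<notin> indeps M \<and> (\<forall>D. D \<subset> C \<longrightarrow> D \<in> indeps M)"

definition matroid_restriction :: "'a set_system \<Rightarrow> 'a set \<Rightarrow> 'a set_system" where
  "matroid_restriction M X = \<lparr>ground = X, indeps = {I \<in> indeps M. I \<subseteq> X}\<rparr>"

definition matroid_contraction :: "'a set_system \<Rightarrow> 'a set \<Rightarrow> 'a set_system" where
  "matroid_contraction M X =
     \<lparr>ground = ground M - X,
      indeps = {I. I \<subseteq> ground M - X \<and> (\<exists>B. basis_of M X B \<and> I \<union> B \<in> indeps M)}\<rparr>"

section \<open>Tutte polynomial and \<open>h\<close>-vector\<close>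

text \<open>A polynomial in \<open>y\<close> (outer variable) with coefficients in \<open>\<int>[x]\<close>: the two factors
  below are \<open>x - 1\<close> and \<open>y - 1\<close>. Hence \<open>poly (tutte M) 1\<close> is \<open>T\<^sub>M(x,1)\<close>.\<close>

definition tutte :: "'a set_system \<Rightarrow> int poly poly" where
  "tutte M = (\<Sum>X \<in> Pow (ground M).
     [:[:-1, 1:]:] ^ (rank M - rank_of M X) * [:-1, 1:] ^ (card X - rank_of M X))"

definition h_vector :: "'a set_system \<Rightarrow> nat \<Rightarrow> int" where
  "h_vector M k = poly.coeff (poly (tutte M) 1) (rank M - k)"

definition h_poly :: "'a set_system \<Rightarrow> int poly" where
  "h_poly M = (\<Sum>k\<le>rank M. monom (h_vector M k) k)"

section \<open>Strata\<close>

text \<open>Throughout, \<open>B\<close> is the fixed basis and \<open>R = ground M - B\<close>.\<close>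

definition fundamental_circuit :: "'a set_system \<Rightarrow> 'a set \<Rightarrow> 'a \<Rightarrow> 'a set" where
  "fundamental_circuit M B i = (THE C. circuit M C \<and> C \<subseteq> insert i B)"

definition mult :: "'a set_system \<Rightarrow> 'a set \<Rightarrow> 'a set \<Rightarrow> 'a \<Rightarrow> nat" where
  "mult M B \<sigma> e = card {i \<in> \<sigma>. e \<in> fundamental_circuit M B i}"

definition U_set :: "'a set_system \<Rightarrow> 'a set \<Rightarrow> 'a set \<Rightarrow> 'a set" where
  "U_set M B \<sigma> = {e \<in> ground M. mult M B \<sigma> e = 1}"

definition A_set :: "'a set_system \<Rightarrow> 'a set \<Rightarrow> 'a set \<Rightarrow> 'a set" where
  "A_set M B \<sigma> = {e \<in> ground M. mult M B \<sigma> e \<ge> 1}"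

definition stratum :: "'a set_system \<Rightarrow> 'a set \<Rightarrow> 'a set \<Rightarrow> bool" where
  "stratum M B \<sigma> \<longleftrightarrow> \<sigma> \<noteq> {} \<and> \<sigma> \<subseteq> ground M - B"

definition dead_stratum :: "'a set_system \<Rightarrow> 'a set \<Rightarrow> 'a set \<Rightarrow> bool" where
  "dead_stratum M B \<sigma> \<longleftrightarrow> stratum M B \<sigma> \<and> U_set M B \<sigma> \<in> indeps M"

text \<open>Only the values at \<open>i \<in> \<sigma>\<close> are meaningful.\<close>

definition baseline :: "'a set_system \<Rightarrow> 'a set \<Rightarrow> 'a set \<Rightarrow> 'a \<Rightarrow> nat" where
  "baseline M B \<sigma> i = card (fundamental_circuit M B i \<inter> U_set M B \<sigma>)"

definition baseline_size :: "'a set_system \<Rightarrow> 'a set \<Rightarrow> 'a set \<Rightarrow> nat" where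
  "baseline_size M B \<sigma> = (\<Sum>i\<in>\<sigma>. baseline M B \<sigma> i)"

definition can_be_fired :: "'a set_system \<Rightarrow> 'a set \<Rightarrow> 'a set \<Rightarrow> ('a \<Rightarrow> nat) \<Rightarrow> bool" where
  "can_be_fired M B \<sigma> a \<longleftrightarrow> (\<forall>i\<in>\<sigma>. a i \<ge> baseline M B \<sigma> i)"

definition dead_node :: "'a set_system \<Rightarrow> 'a set \<Rightarrow> 'a set \<Rightarrow> 'a set_system" where
  "dead_node M B \<sigma> = matroid_contraction (matroid_restriction M (A_set M B \<sigma>)) (U_set M B \<sigma>)"

text \<open>A vector indexed by \<open>R - \<tau>\<close> is an extensional function, so that distinct elements of the
  set below are distinct vectors.\<close>

definition Ext :: "'a set_system \<Rightarrow> 'a set \<Rightarrow> 'a set \<Rightarrow> ('a \<Rightarrow> nat) set" where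
  "Ext M B \<tau> = {c \<in> (ground M - B - \<tau>) \<rightarrow>\<^sub>E UNIV.
     \<not> (\<exists>\<sigma>. stratum M B \<sigma> \<and> \<tau> \<subset> \<sigma> \<and>
          can_be_fired M B \<sigma> (\<lambda>i. if i \<in> \<tau> then baseline M B \<tau> i else c i))}"

definition ext_poly :: "'a set_system \<Rightarrow> 'a set \<Rightarrow> 'a set \<Rightarrow> int poly" where
  "ext_poly M B \<tau> = (\<Sum>c \<in> Ext M B \<tau>. monom 1 (\<Sum>i \<in> ground M - B - \<tau>. c i))"

section \<open>Consistency of the definitions\<close>

lemma matroid_restriction:
  assumes "matroid M" and "X \<subseteq> ground M"
  shows "matroid (matroid_restriction M X)"
proof -
  interpret matroid M by fact
  show ?thesis
  proof
    show "finite (ground (matroid_restriction M X))"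
      using assms(2) finite_ground by (auto simp: matroid_restriction_def intro: finite_subset)
  next
    fix I J
    assume "I \<in> indeps (matroid_restriction M X)" "J \<in> indeps (matroid_restriction M X)"
      and "card I < card J"
    then show "\<exists>e\<in>J - I. insert e I \<in> indeps (matroid_restriction M X)"
      using exchange[of I J] by (auto simp: matroid_restriction_def)
  qed (auto simp: matroid_restriction_def empty_indep intro: indeps_down_closed)
qed

context matroid
begin

lemma finite_indep: "I \<in> indeps M \<Longrightarrow> finite I"
  using finite_ground indeps_subset_ground finite_subset by blast

lemma finite_indeps: "finite (indeps M)"
  using finite_ground indeps_subset_ground by (auto intro: finite_subset[of _ "Pow (ground M)"])

lemma basis_of_exists: "\<exists>B. basis_of M X B"
proof -
  let ?S = "{I \<in> indeps M. I \<subseteq> X}"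
  have "finite ?S" "?S \<noteq> {}" using finite_indeps empty_indep by auto
  then obtain B where "B \<in> ?S" "\<forall>B'\<in>?S. B \<subseteq> B' \<longrightarrow> B' = B"
    using finite_has_maximal[of ?S] by (metis (no_types, lifting))
  then show ?thesis by (auto simp: basis_of_def)
qed

lemma basis_of_card_le:
  assumes "basis_of M X B" and "I \<in> indeps M" and "I \<subseteq> X"
  shows "card I \<le> card B"
proof (rule ccontr)
  assume "\<not> card I \<le> card B"
  then obtain e where "e \<in> I - B" "insert e B \<in> indeps M"
    using exchange[of B I] assms by (auto simp: basis_of_def)
  then show False using assms by (auto simp: basis_of_def)
qed

lemma matroid_contraction: "matroid (matroid_contraction M X)"
proof
  show "finite (ground (matroid_contraction M X))"
    using finite_ground by (simp add: matroid_contraction_def)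
next
  fix I J
  assume I: "I \<in> indeps (matroid_contraction M X)" and J: "J \<in> indeps (matroid_contraction M X)"
    and less: "card I < card J"
  from I obtain B where B: "I \<subseteq> ground M - X" "basis_of M X B" "I \<union> B \<in> indeps M"
    by (auto simp: matroid_contraction_def)
  from J obtain B' where B': "J \<subseteq> ground M - X" "basis_of M X B'" "J \<union> B' \<in> indeps M"
    by (auto simp: matroid_contraction_def)
  have "card (I \<union> B) = card I + card B"
    using B finite_indep[OF B(3)] by (intro card_Un_disjoint) (auto simp: basis_of_def)
  moreover have "card (J \<union> B') = card J + card B'"
    using B' finite_indep[OF B'(3)] by (intro card_Un_disjoint) (auto simp: basis_of_def)
  moreover have "card B \<le> card B'"
    using B(2) B'(2) basis_of_card_le by (auto simp: basis_of_def)
  ultimately have "card (I \<union> B) < card (J \<union> B')" using less by simp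
  from exchange[OF B(3) B'(3) this]
  obtain e where e: "e \<in> (J \<union> B') - (I \<union> B)" "insert e (I \<union> B) \<in> indeps M" by blast
  have "e \<notin> B'"
  proof
    assume "e \<in> B'"
    then have "insert e B \<subseteq> X" using B(2) B'(2) by (auto simp: basis_of_def)
    moreover have "insert e B \<in> indeps M" using e(2) by (rule indeps_down_closed) auto
    ultimately show False using e(1) B(2) by (auto simp: basis_of_def)
  qed
  with e B B' show "\<exists>e\<in>J - I. insert e I \<in> indeps (matroid_contraction M X)"
    by (intro bexI[of _ e]) (auto simp: matroid_contraction_def)
next
  show "{} \<in> indeps (matroid_contraction M X)"
    using basis_of_exists[of X] by (auto simp: matroid_contraction_def basis_of_def)
next
  fix I J assume "I \<in> indeps (matroid_contraction M X)" "J \<subseteq> I"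
  then show "J \<in> indeps (matroid_contraction M X)"
    unfolding matroid_contraction_def using indeps_down_closed
    by (simp, meson Un_mono order_refl order_trans)
qed (auto simp: matroid_contraction_def)

lemma rank_of_le_card:
  assumes "X \<subseteq> ground M"
  shows "rank_of M X \<le> card X"
  unfolding rank_of_def using assms empty_indep finite_indeps finite_ground
  by (subst Max_le_iff) (auto intro!: card_mono intro: finite_subset)

lemma rank_of_eq_card_iff:
  assumes "X \<subseteq> ground M"
  shows "rank_of M X = card X \<longleftrightarrow> X \<in> indeps M"
proof
  assume r: "rank_of M X = card X"
  have "rank_of M X \<in> card ` {I \<in> indeps M. I \<subseteq> X}"
    unfolding rank_of_def using empty_indep finite_indeps by (intro Max_in) auto
  then obtain I where "I \<in> indeps M" "I \<subseteq> X" "card I = card X" using r by auto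
  then show "X \<in> indeps M"
    using assms finite_ground by (metis card_subset_eq finite_subset)
next
  assume "X \<in> indeps M"
  then have "card X \<le> rank_of M X"
    unfolding rank_of_def using finite_indeps by (intro Max_ge) auto
  then show "rank_of M X = card X" using rank_of_le_card[OF assms] by simp
qed

text \<open>The right-hand side is \<open>\<Sum>\<^sub>i f\<^sub>i (x - 1)\<^bsup>d-i\<^esup>\<close>, where \<open>f\<^sub>i\<close> counts the independent sets with
  \<open>i\<close> elements, i.e. the polynomial whose coefficients are the \<open>h\<close>-vector of the independence
  complex.\<close>

lemma tutte_at_y_1: "poly (tutte M) 1 = (\<Sum>I \<in> indeps M. [:-1, 1:] ^ (rank M - card I))"
proof -
  have "poly (tutte M) 1 = (\<Sum>X \<in> Pow (ground M).
      if X \<in> indeps M then [:-1, 1:] ^ (rank M - card X) else 0)"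
    unfolding tutte_def poly_sum
  proof (rule sum.cong[OF refl], goal_cases)
    case (1 X)
    then show ?case
      using rank_of_le_card[of X] rank_of_eq_card_iff[of X] by (auto simp: zero_power)
  qed
  also have "\<dots> = (\<Sum>I \<in> Pow (ground M) \<inter> indeps M. [:-1, 1:] ^ (rank M - card I))"
    using finite_ground by (subst sum.inter_restrict) auto
  also have "Pow (ground M) \<inter> indeps M = indeps M" using indeps_subset_ground by auto
  finally show ?thesis .
qed

lemma tutte_at_y_1_h_vector:
  "poly (tutte M) 1 = (\<Sum>k\<le>rank M. monom (h_vector M k) (rank M - k))"
proof -
  have "degree (poly (tutte M) 1) \<le> rank M"
    unfolding tutte_at_y_1
    by (intro degree_sum_le finite_indeps order_trans[OF degree_power_le]) simp
  then have "poly (tutte M) 1 = (\<Sum>k\<le>rank M. monom (poly.coeff (poly (tutte M) 1) k) k)"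
    by (simp add: poly_as_sum_of_monoms')
  also have "\<dots> = (\<Sum>k\<le>rank M. monom (h_vector M k) (rank M - k))"
    unfolding h_vector_def
    by (rule sum.reindex_bij_witness[of _ "\<lambda>k. rank M - k" "\<lambda>k. rank M - k"]) auto
  finally show ?thesis .
qed

lemma dead_node_matroid: "matroid (dead_node M B \<sigma>)"
  unfolding dead_node_def
  by (intro matroid.matroid_contraction matroid_restriction matroid_axioms) (auto simp: A_set_def)

text \<open>The conventions for \<open>\<tau> = {}\<close> hold for the general definitions.\<close>

lemma U_set_empty: "U_set M B {} = {}"
  and A_set_empty: "A_set M B {} = {}"
  and baseline_size_empty: "baseline_size M B {} = 0"
  by (auto simp: U_set_def A_set_def mult_def baseline_size_def)

lemma h_poly_dead_node_empty: "h_poly (dead_node M B {}) = 1"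
proof -
  let ?K = "dead_node M B {}"
  interpret K: matroid ?K by (rule dead_node_matroid)
  have "ground ?K = {}"
    by (simp add: dead_node_def matroid_contraction_def matroid_restriction_def A_set_empty)
  then have i: "indeps ?K = {{}}" using K.indeps_subset_ground K.empty_indep by auto
  then have r: "rank ?K = 0" using K.rank_of_le_card[of "{}"] \<open>ground ?K = {}\<close>
    by (simp add: rank_def)
  show ?thesis by (simp add: h_poly_def h_vector_def K.tutte_at_y_1 i r)
qed

lemma finite_Ext:
  assumes "\<tau> \<subseteq> ground M - B"
  shows "finite (Ext M B \<tau>)"
proof -
  let ?R = "ground M - B"
  have mono: "baseline M B (insert i \<tau>) j \<le> baseline M B \<tau> j" if "j \<in> \<tau>" for i j
    unfolding baseline_def
  proof (rule card_mono)
    show "finite (fundamental_circuit M B j \<inter> U_set M B \<tau>)"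
      using finite_ground by (auto simp: U_set_def)
    show "fundamental_circuit M B j \<inter> U_set M B (insert i \<tau>)
        \<subseteq> fundamental_circuit M B j \<inter> U_set M B \<tau>"
    proof
      fix e assume e: "e \<in> fundamental_circuit M B j \<inter> U_set M B (insert i \<tau>)"
      let ?F = "\<lambda>\<sigma>. {k \<in> \<sigma>. e \<in> fundamental_circuit M B k}"
      have fin: "finite \<tau>" using assms finite_ground finite_subset by blast
      have "card (?F \<tau>) \<le> card (?F (insert i \<tau>))" using fin by (intro card_mono) auto
      moreover have "card (?F \<tau>) > 0" using that e fin by (auto simp: card_gt_0_iff)
      ultimately have "card (?F \<tau>) = 1" using e by (simp add: U_set_def mult_def)
      then show "e \<in> fundamental_circuit M B j \<inter> U_set M B \<tau>"
        using e by (simp add: U_set_def mult_def)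
    qed
  qed
  have "Ext M B \<tau> \<subseteq> (\<Pi>\<^sub>E i \<in> ?R - \<tau>. {..<baseline M B (insert i \<tau>) i})"
  proof
    fix c assume c: "c \<in> Ext M B \<tau>"
    have "c i < baseline M B (insert i \<tau>) i" if i: "i \<in> ?R - \<tau>" for i
    proof (rule ccontr)
      assume "\<not> c i < baseline M B (insert i \<tau>) i"
      then have "can_be_fired M B (insert i \<tau>) (\<lambda>j. if j \<in> \<tau> then baseline M B \<tau> j else c j)"
        using i mono by (auto simp: can_be_fired_def)
      moreover have "stratum M B (insert i \<tau>)" "\<tau> \<subset> insert i \<tau>"
        using i assms by (auto simp: stratum_def)
      ultimately show False using c by (auto simp: Ext_def)
    qed
    then show "c \<in> (\<Pi>\<^sub>E i \<in> ?R - \<tau>. {..<baseline M B (insert i \<tau>) i})"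
      using c by (auto simp: Ext_def PiE_iff)
  qed
  moreover have "finite (\<Pi>\<^sub>E i \<in> ?R - \<tau>. {..<baseline M B (insert i \<tau>) i})"
    using finite_ground by (intro finite_PiE) auto
  ultimately show ?thesis by (rule finite_subset)
qed

end

end

theory Submission
  imports Defs
begin

text \<open>
  Write \<open>[b]\<close> for \<open>1 + t + \<dots> + t\<^bsup>b-1\<^esup>\<close>. The \<open>h\<close>-polynomial of a matroid of rank \<open>r\<close> is the sum of
  \<open>t\<^bsup>|I|\<^esup> (1 - t)\<^bsup>r-|I|\<^esup>\<close> over its independent sets \<open>I\<close>. Restricting this sum for \<open>M|(B \<union> \<tau>)\<close> to those
  \<open>I\<close> that contain \<open>U\<^sub>\<tau>\<close> gives \<open>t\<^bsup>|U\<^sub>\<tau>|\<^esup> h(K\<^sub>\<tau>; t)\<close> if \<open>\<tau>\<close> is dead and \<open>0\<close> if \<open>\<tau>\<close> is live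
  (\<open>ind_sum_dead\<close>, \<open>ind_sum_live\<close>), so the right-hand side of the theorem may be summed over all
  \<open>\<tau> \<subseteq> R\<close>. The theorem then follows from two identities.

  The first one expands the restricted sum over deletions of \<open>M\<close>. Since \<open>U\<^sub>\<tau>\<close> is the disjoint union of
  the sets \<open>C\<^sub>i \<inter> U\<^sub>\<tau>\<close> for \<open>i \<in> \<tau>\<close>, and the elements of each of them are in series in
  \<open>M|(B \<union> \<tau>)\<close>, requiring an independent set to contain \<open>C\<^sub>i \<inter> U\<^sub>\<tau>\<close> costs exactly \<open>[b\<^sub>\<tau>(i)]\<close> times the sum
  over the independent sets avoiding \<open>i\<close> (\<open>sum_series_class\<close>). Applying this to every \<open>i \<in> \<tau>\<close> yields
  (\<open>node_expand\<close>) the sum over \<open>\<rho> \<subseteq> \<tau>\<close> of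
  \<open>(-1)\<^bsup>|\<tau>-\<rho>|\<^esup> (\<Prod>i\<in>\<tau>-\<rho>. [b\<^sub>\<tau>(i)]) h(M|(B \<union> \<rho>); t)\<close>. After exchanging the order of summation, the
  coefficient of \<open>h(M|(B \<union> \<rho>); t)\<close> is, up to sign, the sum over all \<open>\<tau>\<close> with \<open>\<rho> \<subseteq> \<tau> \<subseteq> R\<close> of
  \<open>(-1)\<^bsup>|\<tau>|\<^esup> (\<Prod>i\<in>\<tau>-\<rho>. [b\<^sub>\<tau>(i)]) E\<^sub>\<tau>(t)\<close>.

  The second identity says that this coefficient vanishes unless \<open>\<rho> = R\<close>, where it is \<open>\<plusminus>1\<close>
  (\<open>ext_poly_cancel\<close>, \<open>ext_poly_R\<close>). The product \<open>(\<Prod>i\<in>\<tau>-\<rho>. [b\<^sub>\<tau>(i)]) E\<^sub>\<tau>(t)\<close> enumerates the vectors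
  \<open>a\<close> on \<open>R - \<rho>\<close> that lie below \<open>b\<^sub>\<tau>\<close> on \<open>\<tau> - \<rho>\<close> and restrict to an element of \<open>Ext(\<tau>)\<close> on
  \<open>R - \<tau>\<close>; so it suffices that for each fixed \<open>a\<close> the signed number of such \<open>\<tau>\<close> is zero (\<open>sum_sign_stable\<close>). This uses only that
  \<open>b\<close> is antitone: as in chip-firing, fireable sets are closed under union, hence every \<open>\<kappa>\<close> has a
  unique maximal enlargement by firing (\<open>unique_stable\<close>), and the signed count of the \<open>\<tau>\<close> turns
  into the signed count of all \<open>\<kappa>\<close> between \<open>\<rho>\<close> and \<open>R\<close>.
\<close>

section \<open>Bernstein weights\<close>

text \<open>The contribution of an independent set with \<open>k\<close> elements to the \<open>h\<close>-polynomial of a matroid of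
  rank \<open>r\<close>; up to a binomial coefficient, a Bernstein basis polynomial.\<close>

definition bern :: "nat \<Rightarrow> nat \<Rightarrow> int poly" where
  "bern r k = monom 1 k * [:1, -1:] ^ (r - k)"

text \<open>The \<open>q\<close>-analogue of \<open>b\<close> at \<open>q = t\<close>.\<close>

definition qint :: "nat \<Rightarrow> int poly" where
  "qint b = (\<Sum>k<b. monom 1 k)"

lemma bern_mult:
  assumes "k \<le> m" "l \<le> n"
  shows "bern (m + n) (k + l) = bern m k * bern n l"
proof -
  have "m + n - (k + l) = (m - k) + (n - l)" using assms by simp
  moreover have "monom 1 (k + l) = (monom 1 k * monom 1 l :: int poly)" by (simp add: mult_monom)
  ultimately show ?thesis by (simp add: bern_def power_add)
qed

text \<open>The binomial expansion of \<open>(t + (1 - t))\<^bsup>|S|\<^esup>\<close>: free elements do not change an \<open>h\<close>-polynomial.\<close>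

lemma sum_bern_Pow:
  assumes "finite S"
  shows "(\<Sum>Q\<in>Pow S. bern (card S) (card Q)) = 1"
proof -
  have "(\<Prod>e\<in>S. monom 1 1 + [:1, -1:] :: int poly) =
      (\<Sum>Q\<in>Pow S. (\<Prod>e\<in>Q. monom 1 1) * (\<Prod>e\<in>S-Q. [:1, -1:]))"
    by (rule prod_add[OF assms])
  also have "\<dots> = (\<Sum>Q\<in>Pow S. bern (card S) (card Q))"
    using assms by (intro sum.cong refl)
      (auto simp: bern_def monom_power card_Diff_subset finite_subset)
  also have "monom 1 1 + [:1, -1:] = (1 :: int poly)" by (simp add: monom_altdef one_pCons)
  finally show ?thesis by simp
qed

text \<open>After multiplication by \<open>1 - t\<close> this is the preceding sum without its top term \<open>t\<^bsup>|S|\<^esup>\<close>, that is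
  \<open>1 - t\<^bsup>|S|\<^esup> = (1 - t) [|S|]\<close>.\<close>

lemma sum_bern_psubsets:
  assumes "finite S" "S \<noteq> {}"
  shows "(\<Sum>Q\<in>Pow S - {S}. bern (card S - 1) (card Q)) = qint (card S)"
proof -
  let ?n = "card S"
  have "[:1, -1:] * (\<Sum>Q\<in>Pow S - {S}. bern (?n - 1) (card Q)) =
      (\<Sum>Q\<in>Pow S - {S}. bern ?n (card Q))"
    unfolding sum_distrib_left
  proof (rule sum.cong[OF refl])
    fix Q assume "Q \<in> Pow S - {S}"
    then have "card Q < ?n" using assms by (intro psubset_card_mono) auto
    then have "?n - card Q = Suc (?n - 1 - card Q)" by simp
    then show "[:1, -1:] * bern (?n - 1) (card Q) = bern ?n (card Q)"
      unfolding bern_def by (simp only: power_Suc mult.left_commute)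
  qed
  also have "\<dots> = 1 - bern ?n ?n"
    using assms sum_bern_Pow[of S] by (simp add: sum_diff1)
  also have "\<dots> = [:1, -1:] * qint ?n"
    using one_diff_power_eq[of "monom 1 1 :: int poly" ?n]
    by (simp add: bern_def qint_def monom_power) (simp add: monom_altdef one_pCons)
  finally show ?thesis by (subst (asm) mult_left_cancel) simp_all
qed

text \<open>The hypothesis \<open>swap\<close> is what a series class \<open>S\<close> of a matroid satisfies: as long as \<open>S\<close> is not
  contained in the set, its part inside \<open>S\<close> can be chosen freely. Both sums therefore split over the
  possible parts \<open>K\<close> outside \<open>S\<close>, with the proper subsets of \<open>S\<close> as second factor on the left and
  the subsets of \<open>S - {i}\<close> on the right. As \<open>K\<close> together with \<open>S - {i}\<close> has at most \<open>r\<close>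
  elements, the weight of degree \<open>r\<close> factors into degrees \<open>r - (|S| - 1)\<close> and \<open>|S| - 1\<close>.\<close>

lemma sum_series_class:
  assumes fin: "finite \<J>" "\<And>I. I \<in> \<J> \<Longrightarrow> finite I \<and> card I \<le> r"
    and S: "finite S" "i \<in> S"
    and swap: "\<And>I Q. I \<in> \<J> \<Longrightarrow> Q \<subset> S \<Longrightarrow> (I - S) \<union> Q \<in> \<J>"
  shows "(\<Sum>I | I \<in> \<J> \<and> \<not> S \<subseteq> I. bern r (card I)) =
    qint (card S) * (\<Sum>I | I \<in> \<J> \<and> i \<notin> I. bern r (card I))"
proof -
  let ?K = "(\<lambda>I. I - S) ` \<J>"
  have fibre: "(\<Sum>I | I \<in> \<J> \<and> I \<inter> S \<in> \<Q>. bern r (card I)) =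
      (\<Sum>K\<in>?K. bern (r - (card S - 1)) (card K)) * (\<Sum>Q\<in>\<Q>. bern (card S - 1) (card Q))"
    if Q: "\<And>Q. Q \<in> \<Q> \<Longrightarrow> Q \<subset> S" for \<Q>
  proof -
    have "(\<Sum>I | I \<in> \<J> \<and> I \<inter> S \<in> \<Q>. bern r (card I)) =
        (\<Sum>(K, Q)\<in>?K \<times> \<Q>. bern (r - (card S - 1)) (card K) * bern (card S - 1) (card Q))"
    proof (rule sum.reindex_bij_witness[of _ "\<lambda>(K, Q). K \<union> Q" "\<lambda>I. (I - S, I \<inter> S)"], goal_cases)
      case (3 z)
      then show ?case using Q by (cases z) fastforce
    next
      case (4 z)
      then obtain K Q' where z: "z = (K, Q')" "K \<in> ?K" "Q' \<in> \<Q>" by blast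
      then obtain I where I: "I \<in> \<J>" "K = I - S" by blast
      have "Q' \<subset> S" using Q z by blast
      moreover have "(K \<union> Q') \<inter> S = Q'" using I \<open>Q' \<subset> S\<close> by auto
      ultimately show ?case using swap[OF I(1) \<open>Q' \<subset> S\<close>] I z by auto
    next
      case (5 I)
      then have I: "I \<in> \<J>" and sub: "I \<inter> S \<subset> S" using Q by auto
      have "(I - S) \<union> (S - {i}) \<in> \<J>" using I S by (intro swap) auto
      then have "card ((I - S) \<union> (S - {i})) \<le> r" using fin by blast
      moreover have "card ((I - S) \<union> (S - {i})) = card (I - S) + (card S - 1)"
        using fin(2)[OF I] S by (subst card_Un_disjoint) auto
      ultimately have r: "card (I - S) + (card S - 1) \<le> r" by simp
      have "card (I \<inter> S) < card S" using S sub by (intro psubset_card_mono)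
      moreover have "card I = card (I - S) + card (I \<inter> S)"
        using fin(2)[OF I] by (metis Int_Diff_Un Int_Diff_disjoint add.commute card_Un_disjoint
            finite_Diff finite_Int)
      ultimately show ?case
        using r bern_mult[of "card (I - S)" "r - (card S - 1)" "card (I \<inter> S)" "card S - 1"]
        by auto
    qed auto
    then show ?thesis by (simp add: sum_product sum.cartesian_product)
  qed
  let ?W = "\<Sum>K\<in>?K. bern (r - (card S - 1)) (card K)"
  have sets: "{I. I \<in> \<J> \<and> \<not> S \<subseteq> I} = {I. I \<in> \<J> \<and> I \<inter> S \<in> Pow S - {S}}"
    "{I. I \<in> \<J> \<and> i \<notin> I} = {I. I \<in> \<J> \<and> I \<inter> S \<in> Pow (S - {i})}"
    using S by auto
  have "S \<noteq> {}" "card (S - {i}) = card S - 1" using S by auto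
  have "(\<Sum>I | I \<in> \<J> \<and> \<not> S \<subseteq> I. bern r (card I)) =
      ?W * (\<Sum>Q\<in>Pow S - {S}. bern (card S - 1) (card Q))"
    unfolding sets(1) by (rule fibre) blast
  also have "\<dots> = ?W * qint (card S)"
    by (simp only: sum_bern_psubsets[OF S(1) \<open>S \<noteq> {}\<close>])
  finally have 1: "(\<Sum>I | I \<in> \<J> \<and> \<not> S \<subseteq> I. bern r (card I)) = ?W * qint (card S)" .
  have "(\<Sum>I | I \<in> \<J> \<and> i \<notin> I. bern r (card I)) =
      ?W * (\<Sum>Q\<in>Pow (S - {i}). bern (card S - 1) (card Q))"
    unfolding sets(2) using S(2) by (intro fibre) blast
  also have "\<dots> = ?W"
    using sum_bern_Pow[of "S - {i}"] S(1) \<open>card (S - {i}) = card S - 1\<close>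
    by (simp only: finite_Diff mult_1_right)
  finally show ?thesis unfolding 1 by (simp only: mult.commute)
qed

section \<open>Signed counts\<close>

text \<open>Toggling an element of \<open>R - \<rho>\<close> reverses the sign.\<close>

lemma sum_sign_interval:
  assumes "finite R" "\<rho> \<subset> R"
  shows "(\<Sum>\<kappa> | \<rho> \<subseteq> \<kappa> \<and> \<kappa> \<subseteq> R. (-1) ^ card \<kappa>) = (0 :: int)"
proof -
  obtain x where x: "x \<in> R" "x \<notin> \<rho>" using assms by auto
  let ?S = "{\<kappa>. \<rho> \<subseteq> \<kappa> \<and> \<kappa> \<subseteq> R}" and ?f = "\<lambda>\<kappa>. if x \<in> \<kappa> then \<kappa> - {x} else insert x \<kappa>"
  have mem: "?f \<kappa> \<in> ?S" if "\<kappa> \<in> ?S" for \<kappa>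
    using that x by (cases "x \<in> \<kappa>") auto
  have inv: "?f (?f \<kappa>) = \<kappa>" if "\<kappa> \<in> ?S" for \<kappa>
    by (cases "x \<in> \<kappa>") auto
  have sign: "- ((-1) ^ n) = ((-1) ^ m :: int)" if "m = Suc n \<or> n = Suc m" for m n
    using that by auto
  have "(\<Sum>\<kappa>\<in>?S. (-1) ^ card \<kappa>) = (\<Sum>\<kappa>\<in>?S. - ((-1) ^ card \<kappa>) :: int)"
  proof (rule sum.reindex_bij_witness[of _ ?f ?f], goal_cases)
    case (5 \<kappa>)
    then have "finite \<kappa>" using assms(1) by (auto intro: rev_finite_subset)
    then have "card \<kappa> = Suc (card (?f \<kappa>)) \<or> card (?f \<kappa>) = Suc (card \<kappa>)"
      using card.remove[of \<kappa> x] card_insert_disjoint[of \<kappa> x] by presburger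
    then show ?case by (rule sign)
  qed (rule inv mem, assumption)+
  then show ?thesis by (simp add: sum_negf)
qed

text \<open>The firing rule in isolation: \<open>\<sigma>\<close> can be fired from \<open>a\<close> if \<open>b \<sigma> i \<le> a i\<close> on \<open>\<sigma>\<close>. Enlarging a set
  lowers its thresholds, just as adding vertices to a set of vertices of a graph lowers the number of
  edges leaving it.\<close>

locale antitone_thresholds =
  fixes R :: "'a set" and b :: "'a set \<Rightarrow> 'a \<Rightarrow> nat"
  assumes finite_indices: "finite R"
    and antitone: "\<sigma> \<subseteq> \<tau> \<Longrightarrow> \<tau> \<subseteq> R \<Longrightarrow> i \<in> \<sigma> \<Longrightarrow> b \<tau> i \<le> b \<sigma> i"
begin

text \<open>On \<open>\<tau>\<close> itself the vector counts as large, so only the conditions on \<open>\<sigma> - \<tau>\<close> remain. For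
  \<open>a\<close> equal to \<open>b \<tau>\<close> on \<open>\<tau>\<close> this says that no \<open>\<sigma>\<close> strictly containing \<open>\<tau>\<close> can be fired.\<close>

definition stable :: "('a \<Rightarrow> nat) \<Rightarrow> 'a set \<Rightarrow> bool" where
  "stable a \<tau> \<longleftrightarrow> (\<forall>\<sigma>. \<tau> \<subset> \<sigma> \<longrightarrow> \<sigma> \<subseteq> R \<longrightarrow> (\<exists>i\<in>\<sigma> - \<tau>. a i < b \<sigma> i))"

text \<open>A maximal \<open>\<tau>\<close> that is fireable relative to \<open>\<kappa>\<close> is stable, because a fireable enlargement of it
  would again be fireable relative to \<open>\<kappa>\<close> by antitonicity. Two such sets coincide, since otherwise
  their union would violate the stability of one of them.\<close>

lemma unique_stable:
  assumes "\<kappa> \<subseteq> R"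
  obtains \<tau> where "{\<tau>. \<kappa> \<subseteq> \<tau> \<and> \<tau> \<subseteq> R \<and> stable a \<tau> \<and> (\<forall>i\<in>\<tau> - \<kappa>. b \<tau> i \<le> a i)} = {\<tau>}"
proof -
  let ?F = "{\<tau>. \<kappa> \<subseteq> \<tau> \<and> \<tau> \<subseteq> R \<and> (\<forall>i\<in>\<tau> - \<kappa>. b \<tau> i \<le> a i)}"
  have "finite ?F" using finite_indices by (auto intro: finite_subset[of _ "Pow R"])
  moreover have "\<kappa> \<in> ?F" using assms by auto
  ultimately obtain \<tau> where \<tau>: "\<tau> \<in> ?F" "\<And>\<sigma>. \<sigma> \<in> ?F \<Longrightarrow> \<tau> \<subseteq> \<sigma> \<Longrightarrow> \<sigma> = \<tau>"
    using finite_has_maximal[of ?F] by (metis (no_types, lifting) empty_iff)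
  have stable: "stable a \<tau>"
    unfolding stable_def
  proof (intro allI impI, rule ccontr)
    fix \<sigma> assume \<sigma>: "\<tau> \<subset> \<sigma>" "\<sigma> \<subseteq> R" "\<not> (\<exists>i\<in>\<sigma> - \<tau>. a i < b \<sigma> i)"
    have "b \<sigma> i \<le> a i" if "i \<in> \<sigma> - \<kappa>" for i
    proof (cases "i \<in> \<tau>")
      case True
      then have "b \<sigma> i \<le> b \<tau> i" using \<sigma> by (intro antitone) auto
      also have "\<dots> \<le> a i" using \<tau>(1) True that by auto
      finally show ?thesis .
    qed (use \<sigma> that in force)
    then have "\<sigma> \<in> ?F" using \<sigma> \<tau>(1) by auto
    then show False using \<tau>(2) \<sigma> by blast
  qed
  have sub: "\<tau>\<^sub>2 \<subseteq> \<tau>\<^sub>1"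
    if st: "\<tau>\<^sub>1 \<in> ?F" "\<tau>\<^sub>2 \<in> ?F" "stable a \<tau>\<^sub>1" for \<tau>\<^sub>1 \<tau>\<^sub>2
  proof (rule ccontr)
    assume "\<not> \<tau>\<^sub>2 \<subseteq> \<tau>\<^sub>1"
    then obtain i where i: "i \<in> (\<tau>\<^sub>1 \<union> \<tau>\<^sub>2) - \<tau>\<^sub>1" "a i < b (\<tau>\<^sub>1 \<union> \<tau>\<^sub>2) i"
      using st(1,2) st(3)[unfolded stable_def, rule_format, of "\<tau>\<^sub>1 \<union> \<tau>\<^sub>2"] by blast
    have "b (\<tau>\<^sub>1 \<union> \<tau>\<^sub>2) i \<le> b \<tau>\<^sub>2 i" using i st by (intro antitone) auto
    moreover have "b \<tau>\<^sub>2 i \<le> a i" using i st by auto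
    ultimately show False using i by simp
  qed
  have "{\<tau>. \<kappa> \<subseteq> \<tau> \<and> \<tau> \<subseteq> R \<and> stable a \<tau> \<and> (\<forall>i\<in>\<tau> - \<kappa>. b \<tau> i \<le> a i)} = {\<tau>}" (is "?T = _")
  proof (intro subset_antisym subsetI)
    fix \<tau>' assume "\<tau>' \<in> ?T"
    then have "\<tau>' \<in> ?F" "stable a \<tau>'" by simp_all
    then have "\<tau>' = \<tau>"
      using sub[of \<tau> \<tau>'] sub[of \<tau>' \<tau>] \<tau>(1) stable by (intro subset_antisym)
    then show "\<tau>' \<in> {\<tau>}" by simp
  qed (use \<tau>(1) stable in simp)
  then show ?thesis by (rule that)
qed

text \<open>For stable \<open>\<tau> \<supseteq> \<rho>\<close>, the sum of \<open>(-1)\<^bsup>|\<kappa>|\<^esup>\<close> over the sets \<open>\<kappa>\<close> between \<open>\<rho>\<close> and \<open>\<tau>\<close> relative to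
  which \<open>\<tau>\<close> is fireable is an interval sum. The interval starts at the elements of \<open>\<tau>\<close> that are in
  \<open>\<rho>\<close> or have \<open>a i < b \<tau> i\<close>, so the sum is \<open>(-1)\<^bsup>|\<tau>|\<^esup>\<close> if all elements of \<open>\<tau>\<close> are of this kind
  and \<open>0\<close> otherwise. Summing over \<open>\<tau>\<close> first, each \<open>\<kappa>\<close> occurs exactly once by \<open>unique_stable\<close>,
  and the signs of all \<open>\<kappa>\<close> between \<open>\<rho>\<close> and \<open>R\<close> cancel.\<close>

lemma sum_sign_stable:
  assumes "\<rho> \<subset> R"
  shows "(\<Sum>\<tau> | \<rho> \<subseteq> \<tau> \<and> \<tau> \<subseteq> R \<and> stable a \<tau> \<and> (\<forall>i\<in>\<tau> - \<rho>. a i < b \<tau> i).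
    (-1) ^ card \<tau>) = (0 :: int)"
proof -
  define \<S> where "\<S> = {\<tau>. \<rho> \<subseteq> \<tau> \<and> \<tau> \<subseteq> R \<and> stable a \<tau>}"
  define \<K> where "\<K> = {\<kappa>. \<rho> \<subseteq> \<kappa> \<and> \<kappa> \<subseteq> R}"
  let ?P = "\<lambda>\<kappa> \<tau>. \<kappa> \<subseteq> \<tau> \<and> (\<forall>i\<in>\<tau> - \<kappa>. b \<tau> i \<le> a i)"
  have fin: "finite \<S>" "finite \<K>"
    using finite_indices unfolding \<S>_def \<K>_def by (auto intro: finite_subset[of _ "Pow R"])
  have expand: "(if \<forall>i\<in>\<tau> - \<rho>. a i < b \<tau> i then (-1) ^ card \<tau> else 0) =
      (\<Sum>\<kappa>\<in>\<K>. if ?P \<kappa> \<tau> then (-1) ^ card \<kappa> else (0 :: int))" if \<tau>: "\<tau> \<in> \<S>" for \<tau>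
  proof -
    \<comment> \<open>the elements of \<open>\<tau>\<close> that \<open>\<kappa>\<close> must contain for \<open>\<tau>\<close> to be fireable relative to \<open>\<kappa>\<close>\<close>
    let ?low = "{i \<in> \<tau>. i \<in> \<rho> \<or> a i < b \<tau> i}"
    have "{\<kappa> \<in> \<K>. ?P \<kappa> \<tau>} = {\<kappa>. ?low \<subseteq> \<kappa> \<and> \<kappa> \<subseteq> \<tau>}"
      (is "?A = ?B")
    proof (intro subset_antisym subsetI)
      fix \<kappa> assume "\<kappa> \<in> ?A"
      then have \<kappa>: "\<rho> \<subseteq> \<kappa>" "\<kappa> \<subseteq> \<tau>" "\<And>i. i \<in> \<tau> \<Longrightarrow> i \<notin> \<kappa> \<Longrightarrow> b \<tau> i \<le> a i"
        unfolding \<K>_def by simp_all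
      have "?low \<subseteq> \<kappa>"
      proof
        fix i assume i: "i \<in> ?low"
        then show "i \<in> \<kappa>" using \<kappa>(1) \<kappa>(3)[of i] by (cases "i \<in> \<kappa>") auto
      qed
      then show "\<kappa> \<in> ?B" using \<kappa>(2) by simp
    next
      fix \<kappa> assume \<kappa>: "\<kappa> \<in> ?B"
      then have "b \<tau> i \<le> a i" if "i \<in> \<tau> - \<kappa>" for i
        using that by (intro leI notI) blast
      moreover have "\<rho> \<subseteq> \<kappa>" "\<kappa> \<subseteq> R" using \<kappa> \<tau> unfolding \<S>_def by blast+
      ultimately show "\<kappa> \<in> ?A" using \<kappa> unfolding \<K>_def by simp
    qed
    then have "(\<Sum>\<kappa>\<in>\<K>. if ?P \<kappa> \<tau> then (-1) ^ card \<kappa> else (0 :: int)) =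
        (\<Sum>\<kappa> | ?low \<subseteq> \<kappa> \<and> \<kappa> \<subseteq> \<tau>. (-1) ^ card \<kappa>)"
      unfolding sum.inter_filter[OF fin(2), symmetric] by simp
    also have "\<dots> = (if \<forall>i\<in>\<tau> - \<rho>. a i < b \<tau> i then (-1) ^ card \<tau> else 0)"
    proof (cases "?low = \<tau>")
      case True
      then have "{\<kappa>. ?low \<subseteq> \<kappa> \<and> \<kappa> \<subseteq> \<tau>} = {\<tau>}" by auto
      then show ?thesis using True by auto
    next
      case False
      moreover have "finite \<tau>" using \<tau> finite_indices finite_subset unfolding \<S>_def by blast
      ultimately have "(\<Sum>\<kappa> | ?low \<subseteq> \<kappa> \<and> \<kappa> \<subseteq> \<tau>. (-1) ^ card \<kappa>) = (0 :: int)"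
        by (intro sum_sign_interval) auto
      then show ?thesis using False by auto
    qed
    finally show ?thesis by simp
  qed
  have "{\<tau>. \<rho> \<subseteq> \<tau> \<and> \<tau> \<subseteq> R \<and> stable a \<tau> \<and> (\<forall>i\<in>\<tau> - \<rho>. a i < b \<tau> i)} =
      {\<tau> \<in> \<S>. \<forall>i\<in>\<tau> - \<rho>. a i < b \<tau> i}"
    unfolding \<S>_def by auto
  then have "(\<Sum>\<tau> | \<rho> \<subseteq> \<tau> \<and> \<tau> \<subseteq> R \<and> stable a \<tau> \<and> (\<forall>i\<in>\<tau> - \<rho>. a i < b \<tau> i).
      (-1) ^ card \<tau>) =
      (\<Sum>\<tau>\<in>\<S>. if \<forall>i\<in>\<tau> - \<rho>. a i < b \<tau> i then (-1) ^ card \<tau> else (0 :: int))"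
    using fin by (simp add: sum.inter_filter)
  also have "\<dots> = (\<Sum>\<kappa>\<in>\<K>. \<Sum>\<tau>\<in>\<S>. if ?P \<kappa> \<tau> then (-1) ^ card \<kappa> else 0)"
    by (subst sum.swap) (intro sum.cong refl expand)
  also have "\<dots> = (\<Sum>\<kappa>\<in>\<K>. (-1) ^ card \<kappa>)"
  proof (rule sum.cong[OF refl])
    fix \<kappa> assume "\<kappa> \<in> \<K>"
    then have \<kappa>: "\<rho> \<subseteq> \<kappa>" "\<kappa> \<subseteq> R" unfolding \<K>_def by simp_all
    have "{\<tau> \<in> \<S>. ?P \<kappa> \<tau>} =
        {\<tau>. \<kappa> \<subseteq> \<tau> \<and> \<tau> \<subseteq> R \<and> stable a \<tau> \<and> (\<forall>i\<in>\<tau> - \<kappa>. b \<tau> i \<le> a i)}"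
      using \<kappa>(1) unfolding \<S>_def by auto
    moreover obtain \<tau> where "\<dots> = {\<tau>}" by (rule unique_stable[OF \<kappa>(2)])
    ultimately show "(\<Sum>\<tau>\<in>\<S>. if ?P \<kappa> \<tau> then (-1) ^ card \<kappa> else 0) = ((-1) ^ card \<kappa> :: int)"
      unfolding sum.inter_filter[OF fin(1), symmetric] by simp
  qed
  also have "\<dots> = 0"
    unfolding \<K>_def using finite_indices assms by (rule sum_sign_interval)
  finally show ?thesis .
qed

end

section \<open>Bases\<close>

context matroid
begin

lemma basis_of_extends:
  assumes "J \<in> indeps M" "J \<subseteq> X"
  obtains L where "basis_of M X L" "J \<subseteq> L"
proof -
  let ?S = "{I \<in> indeps M. J \<subseteq> I \<and> I \<subseteq> X}"
  have "finite ?S" "J \<in> ?S" using finite_indeps assms by auto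
  then obtain L where "L \<in> ?S" "\<And>I. I \<in> ?S \<Longrightarrow> L \<subseteq> I \<Longrightarrow> I = L"
    using finite_has_maximal[of ?S] by (metis (no_types, lifting) empty_iff)
  then show ?thesis by (intro that[of L]) (auto simp: basis_of_def)
qed

lemma rank_of_eq_card_basis:
  assumes "basis_of M X L"
  shows "rank_of M X = card L"
  unfolding rank_of_def using assms basis_of_card_le finite_indeps
  by (intro Max_eqI) (auto simp: basis_of_def)

text \<open>Independence of \<open>Y\<close> over \<open>W\<close> can be tested on any basis of \<open>W\<close>: a basis \<open>L\<close> of \<open>W \<union> Y\<close>
  containing \<open>J\<close> has at least \<open>|Z| + |Y|\<close> elements, at most \<open>|Z|\<close> of them in \<open>W\<close>, so it contains
  \<open>Y\<close>.\<close>

lemma indep_Un_of_basis: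
  assumes Z: "basis_of M W Z" and ZY: "Z \<union> Y \<in> indeps M" and disj: "Y \<inter> W = {}"
    and J: "J \<in> indeps M" "J \<subseteq> W"
  shows "J \<union> Y \<in> indeps M"
proof -
  obtain L where L: "basis_of M (W \<union> Y) L" "J \<subseteq> L"
    using basis_of_extends[of J "W \<union> Y"] J by blast
  have ind: "L \<in> indeps M" and fin: "finite L" "finite (Z \<union> Y)"
    using L ZY finite_indep by (auto simp: basis_of_def)
  have "card Z + card Y = card (Z \<union> Y)"
    using fin Z disj by (intro card_Un_disjoint[symmetric]) (auto simp: basis_of_def)
  also have "\<dots> \<le> card L" using Z by (intro basis_of_card_le[OF L(1) ZY]) (auto simp: basis_of_def)
  also have "card L = card (L \<inter> W) + card (L \<inter> Y)"
    using L disj fin by (subst card_Un_disjoint[symmetric])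
      (auto simp: basis_of_def intro!: arg_cong[of _ _ card])
  also have "card (L \<inter> W) \<le> card Z"
    using indeps_down_closed[OF ind] by (intro basis_of_card_le[OF Z]) auto
  finally have "card Y \<le> card (L \<inter> Y)" by simp
  then have "L \<inter> Y = Y" using fin by (intro card_seteq) auto
  then show ?thesis using L(2) by (intro indeps_down_closed[OF ind]) auto
qed

lemma dependent_contains_circuit:
  assumes "X \<subseteq> ground M" "X \<notin> indeps M"
  obtains C where "circuit M C" "C \<subseteq> X"
proof -
  let ?S = "{D. D \<subseteq> X \<and> D \<notin> indeps M}"
  have "finite X" using assms finite_ground finite_subset by blast
  then have "finite ?S" "?S \<noteq> {}" using assms by auto
  then obtain C where "C \<in> ?S" "\<And>D. D \<in> ?S \<Longrightarrow> D \<subseteq> C \<Longrightarrow> D = C"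
    using finite_has_minimal[of ?S] by (metis (no_types, lifting))
  then show ?thesis using assms by (intro that[of C]) (auto simp: circuit_def)
qed

text \<open>The coefficients of \<open>h\<close> are those of \<open>T\<^sub>M(x, 1)\<close> in reverse order, and reversing \<open>(x - 1)\<^bsup>r-m\<^esup>\<close>
  as a polynomial of degree \<open>r\<close> gives \<open>t\<^bsup>m\<^esup> (1 - t)\<^bsup>r-m\<^esup>\<close>.\<close>

lemma h_poly_eq_sum_bern: "h_poly M = (\<Sum>I\<in>indeps M. bern (rank M) (card I))"
proof -
  have reflect: "(\<Sum>k\<le>r. monom (poly.coeff ([:-1, 1:] ^ (r - m)) (r - k)) k) = bern r m"
    if "m \<le> r" for r m
  proof -
    let ?p = "[:-1, 1:] ^ (r - m) :: int poly"
    have p: "[:1, -1:] ^ (r - m) = reflect_poly ?p" "degree ?p = r - m"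
      by (simp_all add: reflect_poly_power reflect_poly_pCons degree_power_eq)
    show ?thesis
      unfolding bern_def p(1) using that
      by (intro poly_eqI)
        (auto simp: coeff_sum coeff_monom_mult coeff_reflect_poly p(2) coeff_eq_0)
  qed
  have card: "card I \<le> rank M" if "I \<in> indeps M" for I
    unfolding rank_def rank_of_def using that finite_indeps indeps_subset_ground by (intro Max_ge) auto
  have "h_poly M = (\<Sum>k\<le>rank M. \<Sum>I\<in>indeps M.
      monom (poly.coeff ([:-1, 1:] ^ (rank M - card I)) (rank M - k)) k)"
    unfolding h_poly_def h_vector_def tutte_at_y_1 by (simp add: coeff_sum monom_sum)
  also have "\<dots> = (\<Sum>I\<in>indeps M. bern (rank M) (card I))"
    by (subst sum.swap) (intro sum.cong refl reflect card)
  finally show ?thesis .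
qed

end


section \<open>Fundamental circuits\<close>

locale based_matroid = matroid M for M :: "'a set_system" +
  fixes B :: "'a set"
  assumes basis: "basis M B"
begin

abbreviation R :: "'a set" where "R \<equiv> ground M - B"
abbreviation circ :: "'a \<Rightarrow> 'a set" where "circ \<equiv> fundamental_circuit M B"
abbreviation U :: "'a set \<Rightarrow> 'a set" where "U \<equiv> U_set M B"
abbreviation A :: "'a set \<Rightarrow> 'a set" where "A \<equiv> A_set M B"
abbreviation base :: "'a set \<Rightarrow> 'a \<Rightarrow> nat" where "base \<equiv> baseline M B"

lemma B_indep: "B \<in> indeps M" and B_ground: "B \<subseteq> ground M"
  using basis by (auto simp: basis_def basis_of_def)

lemma finite_B: "finite B" and finite_R: "finite R"
  using B_ground finite_ground finite_subset by auto

lemma finite_subset_R: "\<tau> \<subseteq> R \<Longrightarrow> finite \<tau>"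
  using finite_R by (rule rev_finite_subset)

text \<open>Otherwise extend \<open>C - {f}\<close>, for some \<open>f \<in> C - D\<close>, to a basis of \<open>insert i B\<close>. It omits \<open>f\<close> and has
  \<open>|B|\<close> elements, so it is \<open>insert i B - {f}\<close> and contains the circuit \<open>D\<close>.\<close>

lemma circuit_subset_circuit:
  assumes i: "i \<in> R" and C: "circuit M C" "C \<subseteq> insert i B" and D: "circuit M D" "D \<subseteq> insert i B"
  shows "C \<subseteq> D"
proof (rule ccontr)
  assume "\<not> C \<subseteq> D"
  then obtain f where f: "f \<in> C" "f \<notin> D" by auto
  then have "C - {f} \<in> indeps M" using C by (auto simp: circuit_def)
  then obtain L where L: "basis_of M (insert i B) L" "C - {f} \<subseteq> L"
    using basis_of_extends[of "C - {f}" "insert i B"] C by blast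
  then have L': "L \<in> indeps M" "L \<subseteq> insert i B" by (auto simp: basis_of_def)
  have "f \<notin> L"
  proof
    assume "f \<in> L"
    then have "C \<subseteq> L" using L(2) by auto
    then show False using C(1) indeps_down_closed[OF L'(1)] by (auto simp: circuit_def)
  qed
  then have "L \<subseteq> insert i B - {f}" using L' by auto
  moreover have "card (insert i B - {f}) = card B"
    using f C i finite_B by (subst card_Diff_singleton) auto
  then have "card (insert i B - {f}) \<le> card L"
    using basis_of_card_le[OF L(1) B_indep] by auto
  ultimately have "L = insert i B - {f}" using finite_B by (intro card_seteq) auto
  then have "D \<subseteq> L" using D f by auto
  then show False using D(1) indeps_down_closed[OF L'(1)] by (auto simp: circuit_def)
qed

lemma circ_unique:
  assumes "i \<in> R" "circuit M C" "C \<subseteq> insert i B"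
  shows "circ i = C"
  unfolding fundamental_circuit_def
proof (rule the_equality)
  fix D assume "circuit M D \<and> D \<subseteq> insert i B"
  then show "D = C"
    using circuit_subset_circuit[OF assms(1), of C D] circuit_subset_circuit[OF assms(1), of D C] assms
    by (intro subset_antisym) simp_all
qed (use assms in simp)

lemma circ:
  assumes i: "i \<in> R"
  shows circuit_circ: "circuit M (circ i)" and circ_subset: "circ i \<subseteq> insert i B"
    and self_in_circ: "i \<in> circ i"
proof -
  have "insert i B \<notin> indeps M" using i basis by (auto simp: basis_def basis_of_def)
  then obtain C where "circuit M C" "C \<subseteq> insert i B"
    using dependent_contains_circuit[of "insert i B"] i B_ground by blast
  then show C: "circuit M (circ i)" "circ i \<subseteq> insert i B"
    using circ_unique[OF i] by blast+
  show "i \<in> circ i"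
  proof (rule ccontr)
    assume "i \<notin> circ i"
    then have "circ i \<subseteq> B" using C by auto
    then show False using C(1) indeps_down_closed[OF B_indep] by (auto simp: circuit_def)
  qed
qed

lemma exchange_indep:
  assumes i: "i \<in> R" and f: "f \<in> circ i"
  shows "insert i B - {f} \<in> indeps M"
proof (rule ccontr)
  assume "insert i B - {f} \<notin> indeps M"
  then obtain D where D: "circuit M D" "D \<subseteq> insert i B - {f}"
    using dependent_contains_circuit[of "insert i B - {f}"] i B_ground by blast
  then have "circ i = D" by (intro circ_unique[OF i]) auto
  then show False using f D by auto
qed

text \<open>Every element of \<open>W - Z\<close> closes a circuit with \<open>Z\<close>.\<close>

lemma basis_of_subset_B:
  assumes "Z \<subseteq> B" "Z \<subseteq> W" and W: "\<And>w. w \<in> W - Z \<Longrightarrow> w \<in> R \<and> circ w \<subseteq> insert w Z"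
  shows "basis_of M W Z"
  unfolding basis_of_def
proof (intro conjI ballI impI)
  show "Z \<in> indeps M" using assms(1) by (rule indeps_down_closed[OF B_indep])
  fix I assume I: "I \<in> indeps M" "Z \<subseteq> I \<and> I \<subseteq> W"
  show "I = Z"
  proof (rule ccontr)
    assume "I \<noteq> Z"
    then obtain w where w: "w \<in> I" "w \<in> W - Z" using I by auto
    then have "circ w \<subseteq> I" "w \<in> R" using W[OF w(2)] I by auto
    then have "circ w \<in> indeps M" "circuit M (circ w)"
      using indeps_down_closed[OF I(1)] circuit_circ by blast+
    then show False by (simp add: circuit_def)
  qed
qed (rule assms)

lemma mem_A:
  assumes "\<tau> \<subseteq> R"
  shows "e \<in> A \<tau> \<longleftrightarrow> (\<exists>i\<in>\<tau>. e \<in> circ i)"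
proof -
  have "finite {i \<in> \<tau>. e \<in> circ i}" using finite_subset_R[OF assms] by simp
  then have "mult M B \<tau> e \<ge> 1 \<longleftrightarrow> (\<exists>i\<in>\<tau>. e \<in> circ i)"
    unfolding mult_def by (auto simp: Suc_le_eq card_gt_0_iff)
  moreover have "e \<in> ground M" if "i \<in> \<tau>" "e \<in> circ i" for i
    using circ_subset[of i] B_ground assms that by blast
  ultimately show ?thesis unfolding A_set_def by blast
qed

text \<open>Stated with \<open>\<tau> - {i}\<close> because the form \<open>\<dots> \<longrightarrow> j = i\<close> makes the simplifier rewrite every element
  to \<open>i\<close>.\<close>

lemma mem_U:
  assumes "\<tau> \<subseteq> R"
  shows "e \<in> U \<tau> \<longleftrightarrow> (\<exists>i\<in>\<tau>. e \<in> circ i \<and> (\<forall>j\<in>\<tau> - {i}. e \<notin> circ j))"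
proof -
  have "mult M B \<tau> e = 1 \<longleftrightarrow> (\<exists>i. {i \<in> \<tau>. e \<in> circ i} = {i})"
    unfolding mult_def by (simp add: card_1_singleton_iff)
  also have "\<dots> \<longleftrightarrow> (\<exists>i\<in>\<tau>. e \<in> circ i \<and> (\<forall>j\<in>\<tau> - {i}. e \<notin> circ j))"
    by blast
  finally have "mult M B \<tau> e = 1 \<longleftrightarrow> (\<exists>i\<in>\<tau>. e \<in> circ i \<and> (\<forall>j\<in>\<tau> - {i}. e \<notin> circ j))" .
  moreover have "e \<in> ground M" if "i \<in> \<tau>" "e \<in> circ i" for i
    using circ_subset[of i] B_ground assms that by blast
  ultimately show ?thesis unfolding U_set_def by blast
qed

text \<open>The baseline \<open>b\<^sub>\<tau>(i)\<close> is the size of this set. In \<open>M|(B \<union> \<tau>)\<close> its elements are in series, since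
  \<open>C\<^sub>i\<close> is the only fundamental circuit of \<open>\<tau>\<close> that meets it.\<close>

definition series :: "'a set \<Rightarrow> 'a \<Rightarrow> 'a set" where
  "series \<tau> i = circ i \<inter> U \<tau>"

lemma base_eq_card_series: "base \<tau> i = card (series \<tau> i)"
  by (simp add: baseline_def series_def)

lemma mem_series:
  assumes "\<tau> \<subseteq> R" "i \<in> \<tau>"
  shows "e \<in> series \<tau> i \<longleftrightarrow> e \<in> circ i \<and> (\<forall>j\<in>\<tau> - {i}. e \<notin> circ j)"
  unfolding series_def Int_iff mem_U[OF assms(1)] using assms(2) by blast

lemma circ_Int_R:
  assumes "i \<in> R" "j \<in> R" "i \<in> circ j"
  shows "i = j"
  using circ_subset[OF assms(2)] assms by auto

lemma self_in_series:
  assumes "\<tau> \<subseteq> R" "i \<in> \<tau>"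
  shows "i \<in> series \<tau> i"
proof -
  have "i \<in> R" using assms by auto
  moreover have "i \<notin> circ j" if "j \<in> \<tau> - {i}" for j
    using circ_Int_R[OF \<open>i \<in> R\<close>, of j] that assms(1) by auto
  ultimately show ?thesis using mem_series[OF assms] self_in_circ by simp
qed

lemma finite_series:
  assumes "\<tau> \<subseteq> R" "i \<in> \<tau>"
  shows "finite (series \<tau> i)"
  by (rule finite_subset[of _ "insert i B"]) (use circ_subset[of i] assms finite_B in \<open>auto simp: series_def\<close>)

lemma series_subset:
  assumes "\<tau> \<subseteq> R" "i \<in> \<tau>"
  shows "series \<tau> i \<subseteq> insert i B"
  using circ_subset[of i] assms by (auto simp: series_def)

lemma series_disjoint:
  assumes "\<tau> \<subseteq> R" "i \<in> \<tau>" "j \<in> \<tau>" "i \<noteq> j"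
  shows "series \<tau> i \<inter> series \<tau> j = {}"
  using assms mem_series[OF assms(1,2)] mem_series[OF assms(1,3)] by auto

lemma U_eq_UN_series: "\<tau> \<subseteq> R \<Longrightarrow> U \<tau> = (\<Union>i\<in>\<tau>. series \<tau> i)"
  using mem_U[of \<tau>] unfolding series_def by (intro subset_antisym subsetI) auto

lemma baseline_size_eq_card_U:
  assumes "\<tau> \<subseteq> R"
  shows "baseline_size M B \<tau> = card (U \<tau>)"
  unfolding U_eq_UN_series[OF assms] baseline_size_def base_eq_card_series
proof (rule card_UN_disjoint[symmetric])
  show "finite \<tau>" by (rule finite_subset_R[OF assms])
next
  show "\<forall>i\<in>\<tau>. finite (series \<tau> i)" using finite_series[OF assms] by (rule ballI)
next
  show "\<forall>i\<in>\<tau>. \<forall>j\<in>\<tau>. i \<noteq> j \<longrightarrow> series \<tau> i \<inter> series \<tau> j = {}"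
    using series_disjoint[OF assms] by (intro ballI impI)
qed

lemma series_antitone:
  assumes "\<sigma> \<subseteq> \<tau>" "\<tau> \<subseteq> R" "i \<in> \<sigma>"
  shows "series \<tau> i \<subseteq> series \<sigma> i"
proof
  fix e assume "e \<in> series \<tau> i"
  moreover have "i \<in> \<tau>" "\<sigma> \<subseteq> R" using assms by auto
  ultimately have "e \<in> circ i" "\<forall>j\<in>\<tau> - {i}. e \<notin> circ j"
    using mem_series[OF assms(2)] by simp_all
  then show "e \<in> series \<sigma> i"
    unfolding mem_series[OF \<open>\<sigma> \<subseteq> R\<close> assms(3)] using assms(1) by (simp add: subset_iff)
qed

lemma base_antitone:
  assumes "\<sigma> \<subseteq> \<tau>" "\<tau> \<subseteq> R" "i \<in> \<sigma>"
  shows "base \<tau> i \<le> base \<sigma> i"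
  unfolding base_eq_card_series
proof (rule card_mono)
  show "finite (series \<sigma> i)" using assms by (intro finite_series) auto
qed (rule series_antitone[OF assms])

sublocale antitone_thresholds R base
  by unfold_locales (rule finite_R, rule base_antitone)

text \<open>For \<open>f\<close> in the class but not in \<open>Q\<close>, the set \<open>insert i B - {f}\<close> is independent. It contains
  \<open>Q\<close> and the elements of \<open>B\<close> outside the class, and the latter form a basis of everything in
  \<open>B \<union> \<tau>\<close> outside the class, because every other fundamental circuit avoids the class.\<close>

lemma series_swap:
  assumes \<tau>: "\<tau> \<subseteq> R" and i: "i \<in> \<tau>" and J: "J \<in> indeps M" "J \<subseteq> B \<union> \<tau>" and Q: "Q \<subset> series \<tau> i"
  shows "(J - series \<tau> i) \<union> Q \<in> indeps M"
proof -
  let ?S = "series \<tau> i"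
  obtain f where f: "f \<in> ?S" "f \<notin> Q" using Q by auto
  have iR: "i \<in> R" using \<tau> i by auto
  have "insert i B - {f} \<in> indeps M"
    using f by (intro exchange_indep[OF iR]) (simp add: series_def)
  then have ZQ: "(B - ?S) \<union> Q \<in> indeps M"
    by (rule indeps_down_closed) (use f Q series_subset[OF \<tau> i] in auto)
  have "basis_of M (B \<union> \<tau> - ?S) (B - ?S)"
  proof (rule basis_of_subset_B)
    fix w assume w: "w \<in> (B \<union> \<tau> - ?S) - (B - ?S)"
    then have "w \<in> \<tau>" "w \<noteq> i" using self_in_series[OF \<tau> i] by auto
    then have "circ w \<inter> ?S = {}" using mem_series[OF \<tau> i] by auto
    moreover have "w \<in> R" using \<open>w \<in> \<tau>\<close> \<tau> by auto
    ultimately show "w \<in> R \<and> circ w \<subseteq> insert w (B - ?S)" using circ_subset[of w] by auto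
  qed auto
  then show ?thesis
  proof (rule indep_Un_of_basis)
    show "J - ?S \<in> indeps M" by (rule indeps_down_closed[OF J(1)]) auto
  qed (use ZQ Q J in auto)
qed

section \<open>Expanding a node of the sum over deletions\<close>

text \<open>Independent sets of \<open>M|(B \<union> \<tau>)\<close> containing the classes indexed by \<open>X\<close> and avoiding \<open>D\<close>. The case
  \<open>X = \<tau>\<close>, \<open>D = {}\<close> is the contribution of \<open>\<tau>\<close> to the theorem; the case \<open>X = {}\<close> is the
  \<open>h\<close>-polynomial of a deletion.\<close>

definition ind_sum :: "'a set \<Rightarrow> 'a set \<Rightarrow> 'a set \<Rightarrow> int poly" where
  "ind_sum \<tau> X D = (\<Sum>I | I \<in> indeps M \<and> I \<subseteq> B \<union> \<tau> \<and> (\<forall>j\<in>X. series \<tau> j \<subseteq> I) \<and> D \<inter> I = {}.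
     bern (card B) (card I))"

lemma card_indep_le: "I \<in> indeps M \<Longrightarrow> card I \<le> card B"
  using basis indeps_subset_ground unfolding basis_def by (auto intro: basis_of_card_le)

text \<open>The conditions given by \<open>X\<close> and \<open>D\<close> do not involve the class of \<open>i\<close>, so \<open>sum_series_class\<close>
  applies to the sets that do not contain this class.\<close>

lemma ind_sum_insert:
  assumes \<tau>: "\<tau> \<subseteq> R" and i: "i \<in> \<tau>" "i \<notin> X" "i \<notin> D" and X: "X \<subseteq> \<tau>" and D: "D \<subseteq> \<tau>"
  shows "ind_sum \<tau> (insert i X) D = ind_sum \<tau> X D - qint (base \<tau> i) * ind_sum \<tau> X (insert i D)"
proof -
  let ?S = "series \<tau> i"
  let ?w = "\<lambda>I. bern (card B) (card I)"
  let ?J = "{I. I \<in> indeps M \<and> I \<subseteq> B \<union> \<tau> \<and> (\<forall>j\<in>X. series \<tau> j \<subseteq> I) \<and> D \<inter> I = {}}"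
  have fin: "finite ?J" using finite_indeps by simp
  have D_S: "D \<inter> ?S = {}" using series_subset[OF \<tau> i(1)] D \<tau> i(3) by auto
  have X_S: "series \<tau> j \<inter> ?S = {}" if "j \<in> X" for j
    using series_disjoint[OF \<tau>, of j i] i X that by auto
  have "(\<Sum>I | I \<in> ?J \<and> \<not> ?S \<subseteq> I. ?w I) = qint (card ?S) * (\<Sum>I | I \<in> ?J \<and> i \<notin> I. ?w I)"
  proof (rule sum_series_class)
    fix I Q assume I: "I \<in> ?J" and Q: "Q \<subset> ?S"
    have "(I - ?S) \<union> Q \<in> indeps M" using I by (intro series_swap[OF \<tau> i(1) _ _ Q]) auto
    moreover have "(I - ?S) \<union> Q \<subseteq> B \<union> \<tau>"
      using I Q series_subset[OF \<tau> i(1)] i(1) by auto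
    moreover have "series \<tau> j \<subseteq> (I - ?S) \<union> Q" if "j \<in> X" for j
      using X_S[OF that] I that by auto
    moreover have "D \<inter> ((I - ?S) \<union> Q) = {}" using I Q D_S by auto
    ultimately show "(I - ?S) \<union> Q \<in> ?J" by simp
  qed (use fin finite_indep card_indep_le finite_series[OF \<tau> i(1)] self_in_series[OF \<tau> i(1)] in auto)
  moreover have "(\<Sum>I | I \<in> ?J \<and> i \<notin> I. ?w I) = ind_sum \<tau> X (insert i D)"
    unfolding ind_sum_def by (intro sum.cong) auto
  moreover have "(\<Sum>I | I \<in> ?J \<and> ?S \<subseteq> I. ?w I) = ind_sum \<tau> (insert i X) D"
    unfolding ind_sum_def by (intro sum.cong) auto
  moreover have "(\<Sum>I\<in>?J. ?w I) = (\<Sum>I | I \<in> ?J \<and> ?S \<subseteq> I. ?w I) + (\<Sum>I | I \<in> ?J \<and> \<not> ?S \<subseteq> I. ?w I)"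
    using sum.Int_Diff[OF fin, of ?w "{I. ?S \<subseteq> I}"]
    by (simp add: Int_def set_diff_eq)
  ultimately show ?thesis by (simp add: base_eq_card_series ind_sum_def[of \<tau> X D])
qed

lemma ind_sum_expand:
  assumes \<tau>: "\<tau> \<subseteq> R" and "X \<subseteq> \<tau>" "D \<subseteq> \<tau>" "X \<inter> D = {}"
  shows "ind_sum \<tau> X D =
    (\<Sum>Y\<in>Pow X. (-1) ^ card Y * (\<Prod>i\<in>Y. qint (base \<tau> i)) * ind_sum \<tau> {} (D \<union> Y))"
proof -
  have "finite X" using finite_subset_R[OF \<tau>] assms(2) finite_subset by blast
  then show ?thesis using assms(2-)
  proof (induction X arbitrary: D)
    case empty
    then show ?case by simp
  next
    case (insert i X)
    let ?c = "\<lambda>Y. (-1) ^ card Y * (\<Prod>i\<in>Y. qint (base \<tau> i))"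
    have inj: "inj_on (insert i) (Pow X)"
      using insert.hyps(2) by (intro inj_onI) (metis PowD insert_ident subsetD)
    have c: "?c (insert i Y) = - (qint (base \<tau> i) * ?c Y)" if "Y \<in> Pow X" for Y
    proof -
      have "finite Y" "i \<notin> Y" using that insert.hyps finite_subset by blast+
      then show ?thesis by simp
    qed
    have "ind_sum \<tau> (insert i X) D = ind_sum \<tau> X D - qint (base \<tau> i) * ind_sum \<tau> X (insert i D)"
      using insert.prems insert.hyps by (intro ind_sum_insert[OF \<tau>]) auto
    also have "ind_sum \<tau> X D = (\<Sum>Y\<in>Pow X. ?c Y * ind_sum \<tau> {} (D \<union> Y))"
      using insert.prems by (intro insert.IH) auto
    also have "ind_sum \<tau> X (insert i D) = (\<Sum>Y\<in>Pow X. ?c Y * ind_sum \<tau> {} (insert i D \<union> Y))"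
      using insert.prems insert.hyps by (intro insert.IH) auto
    also have "qint (base \<tau> i) * \<dots> =
        - (\<Sum>Y\<in>insert i ` Pow X. ?c Y * ind_sum \<tau> {} (D \<union> Y))"
      unfolding sum.reindex[OF inj] sum_distrib_left sum_negf[symmetric] o_def
      by (intro sum.cong refl) (simp add: c mult.assoc del: prod.insert_if card_insert_if)
    also have "(\<Sum>Y\<in>Pow X. ?c Y * ind_sum \<tau> {} (D \<union> Y)) - \<dots> =
        (\<Sum>Y\<in>Pow (insert i X). ?c Y * ind_sum \<tau> {} (D \<union> Y))"
      unfolding Pow_insert using insert.hyps
      by (subst sum.union_disjoint) auto
    finally show ?case .
  qed
qed

text \<open>This is \<open>h(M|(B \<union> \<rho>); t)\<close>, as \<open>B\<close> is a basis of the restriction.\<close>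

definition del_sum :: "'a set \<Rightarrow> int poly" where
  "del_sum \<rho> = (\<Sum>I | I \<in> indeps M \<and> I \<subseteq> B \<union> \<rho>. bern (card B) (card I))"

lemma ind_sum_eq_del_sum:
  assumes "\<tau> \<subseteq> R" "D \<subseteq> \<tau>"
  shows "ind_sum \<tau> {} D = del_sum (\<tau> - D)"
  unfolding ind_sum_def del_sum_def using assms by (intro sum.cong) auto

lemma h_poly_eq_del_sum: "h_poly M = del_sum R"
proof -
  have "rank M = card B"
    using basis unfolding rank_def basis_def by (rule rank_of_eq_card_basis)
  moreover have "{I. I \<in> indeps M \<and> I \<subseteq> B \<union> R} = indeps M"
    using indeps_subset_ground by auto
  ultimately show ?thesis by (simp add: h_poly_eq_sum_bern del_sum_def)
qed

lemma node_expand: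
  assumes \<tau>: "\<tau> \<subseteq> R"
  shows "ind_sum \<tau> \<tau> {} = (\<Sum>\<rho>\<in>Pow \<tau>.
    (-1) ^ card (\<tau> - \<rho>) * (\<Prod>i\<in>\<tau> - \<rho>. qint (base \<tau> i)) * del_sum \<rho>)"
proof -
  have "ind_sum \<tau> \<tau> {} = (\<Sum>Y\<in>Pow \<tau>.
      (-1) ^ card Y * (\<Prod>i\<in>Y. qint (base \<tau> i)) * ind_sum \<tau> {} Y)"
    using ind_sum_expand[OF \<tau>, of \<tau> "{}"] by simp
  also have "\<dots> = (\<Sum>\<rho>\<in>Pow \<tau>.
      (-1) ^ card (\<tau> - \<rho>) * (\<Prod>i\<in>\<tau> - \<rho>. qint (base \<tau> i)) * del_sum \<rho>)"
    by (rule sum.reindex_bij_witness[of _ "\<lambda>\<rho>. \<tau> - \<rho>" "\<lambda>Y. \<tau> - Y"])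
      (auto simp: ind_sum_eq_del_sum[OF \<tau>] double_diff)
  finally show ?thesis .
qed

section \<open>Dead and live strata\<close>

lemma basis_of_A:
  assumes "\<tau> \<subseteq> R"
  shows "basis_of M (A \<tau>) (B \<inter> A \<tau>)"
proof (rule basis_of_subset_B)
  fix w assume w: "w \<in> A \<tau> - (B \<inter> A \<tau>)"
  then obtain i where i: "i \<in> \<tau>" "w \<in> circ i" using mem_A[OF assms] by auto
  then have "w = i" "i \<in> R" using circ_subset[of i] w assms by auto
  moreover have "circ i \<subseteq> A \<tau>" using mem_A[OF assms] i by auto
  ultimately show "w \<in> R \<and> circ w \<subseteq> insert w (B \<inter> A \<tau>)" using circ_subset[of i] by auto
qed auto

lemma U_subset_A: "\<tau> \<subseteq> R \<Longrightarrow> U \<tau> \<subseteq> A \<tau>"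
  unfolding U_set_def A_set_def by auto

lemma A_subset: "\<tau> \<subseteq> R \<Longrightarrow> A \<tau> \<subseteq> B \<union> \<tau>"
  using mem_A circ_subset by blast

lemma subset_A: "\<tau> \<subseteq> R \<Longrightarrow> \<tau> \<subseteq> A \<tau>"
  using mem_A self_in_circ by blast

text \<open>An independent set is its own only basis.\<close>

lemma indeps_dead_node:
  assumes \<tau>: "\<tau> \<subseteq> R" and dead: "U \<tau> \<in> indeps M"
  shows "indeps (dead_node M B \<tau>) = {I. I \<subseteq> A \<tau> - U \<tau> \<and> I \<union> U \<tau> \<in> indeps M}"
proof -
  have "basis_of (matroid_restriction M (A \<tau>)) (U \<tau>) I \<longleftrightarrow> I = U \<tau>" for I
    using dead U_subset_A[OF \<tau>] unfolding basis_of_def matroid_restriction_def by auto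
  then show ?thesis
    using U_subset_A[OF \<tau>]
    by (auto simp: dead_node_def matroid_contraction_def matroid_restriction_def)
qed

lemma rank_dead_node:
  assumes \<tau>: "\<tau> \<subseteq> R" and dead: "U \<tau> \<in> indeps M"
  shows "rank (dead_node M B \<tau>) + card (U \<tau>) = card (B \<inter> A \<tau>)"
proof -
  let ?K = "dead_node M B \<tau>"
  interpret K: matroid ?K by (rule dead_node_matroid)
  obtain L where L: "basis_of M (A \<tau>) L" "U \<tau> \<subseteq> L"
    using basis_of_extends[OF dead U_subset_A[OF \<tau>]] .
  then have L': "L \<in> indeps M" "L \<subseteq> A \<tau>" "\<And>I. I \<in> indeps M \<Longrightarrow> L \<subseteq> I \<Longrightarrow> I \<subseteq> A \<tau> \<Longrightarrow> I = L"
    by (auto simp: basis_of_def)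
  have "basis_of ?K (ground ?K) (L - U \<tau>)"
    unfolding basis_of_def
  proof (intro conjI ballI impI)
    show "L - U \<tau> \<in> indeps ?K"
      unfolding indeps_dead_node[OF \<tau> dead] using L L' by (auto simp: Un_absorb2)
    then show "L - U \<tau> \<subseteq> ground ?K" by (rule K.indeps_subset_ground)
    fix I assume I: "I \<in> indeps ?K" "L - U \<tau> \<subseteq> I \<and> I \<subseteq> ground ?K"
    then have "I \<subseteq> A \<tau> - U \<tau>" "I \<union> U \<tau> \<in> indeps M" using indeps_dead_node[OF \<tau> dead] by auto
    moreover from this have "I \<union> U \<tau> = L" using I L U_subset_A[OF \<tau>] by (intro L') auto
    ultimately show "I = L - U \<tau>" by auto
  qed
  then have "rank ?K = card (L - U \<tau>)" unfolding rank_def by (rule K.rank_of_eq_card_basis)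
  moreover have "card L = card (B \<inter> A \<tau>)"
    using L(1) basis_of_A[OF \<tau>] basis_of_card_le by (intro antisym) (auto simp: basis_of_def)
  moreover have "card (L - U \<tau>) + card (U \<tau>) = card L"
    using L(2) finite_indep[OF L'(1)] by (metis card_Diff_subset card_mono finite_subset le_add_diff_inverse2)
  ultimately show ?thesis by simp
qed

text \<open>Adding \<open>U \<tau>\<close> to the independent sets of the dead node gives the independent sets between
  \<open>U \<tau>\<close> and \<open>A \<tau>\<close>, at the cost of the factor \<open>t\<^bsup>|U \<tau>|\<^esup>\<close>. Passing from \<open>A \<tau>\<close> to \<open>B \<union> \<tau>\<close> only adds
  the elements of \<open>B - A \<tau>\<close>, which lie on no circuit of \<open>M|(B \<union> \<tau>)\<close>.\<close>

lemma ind_sum_dead: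
  assumes \<tau>: "\<tau> \<subseteq> R" and dead: "U \<tau> \<in> indeps M"
  shows "ind_sum \<tau> \<tau> {} = monom 1 (card (U \<tau>)) * h_poly (dead_node M B \<tau>)"
proof -
  let ?K = "dead_node M B \<tau>" and ?r = "card (B \<inter> A \<tau>)"
  interpret K: matroid ?K by (rule dead_node_matroid)
  let ?J = "{J. J \<in> indeps M \<and> U \<tau> \<subseteq> J \<and> J \<subseteq> A \<tau>}"
  have rank: "rank ?K + card (U \<tau>) = ?r" by (rule rank_dead_node[OF \<tau> dead])
  have B_split: "?r + card (B - A \<tau>) = card B"
    using finite_B by (metis card_Int_Diff add.commute)
  have "monom 1 (card (U \<tau>)) * h_poly ?K =
      (\<Sum>I\<in>indeps ?K. monom 1 (card (U \<tau>)) * bern (rank ?K) (card I))"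
    by (simp add: K.h_poly_eq_sum_bern sum_distrib_left)
  also have "\<dots> = (\<Sum>J\<in>?J. bern ?r (card J))"
  proof (rule sum.reindex_bij_witness[of _ "\<lambda>J. J - U \<tau>" "\<lambda>I. I \<union> U \<tau>"], goal_cases)
    case (5 I)
    then have I: "I \<inter> U \<tau> = {}" "I \<union> U \<tau> \<in> indeps M"
      using indeps_dead_node[OF \<tau> dead] by auto
    then have "card (I \<union> U \<tau>) = card I + card (U \<tau>)"
      using finite_indep[OF I(2)] by (intro card_Un_disjoint) auto
    then have "?r - card (I \<union> U \<tau>) = rank ?K - card I" using rank by simp
    then show ?case
      using \<open>card (I \<union> U \<tau>) = card I + card (U \<tau>)\<close>
      by (simp add: bern_def mult_monom add.commute flip: mult.assoc)
  qed (use indeps_dead_node[OF \<tau> dead] U_subset_A[OF \<tau>] in \<open>auto simp: Un_absorb2\<close>)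
  also have "\<dots> = (\<Sum>(J, Z)\<in>?J \<times> Pow (B - A \<tau>).
      bern ?r (card J) * bern (card (B - A \<tau>)) (card Z))"
    using sum_bern_Pow[of "B - A \<tau>"] finite_B
    by (simp add: sum_distrib_left[symmetric] flip: sum.cartesian_product)
  also have "\<dots> = ind_sum \<tau> \<tau> {}"
    unfolding ind_sum_def
  proof (rule sum.reindex_bij_witness[of _ "\<lambda>I. (I \<inter> A \<tau>, I - A \<tau>)" "\<lambda>(J, Z). J \<union> Z"], goal_cases)
    case (1 z)
    then show ?case by (cases z) auto
  next
    case (2 z)
    then obtain J Z where z: "z = (J, Z)" "J \<in> ?J" "Z \<subseteq> B - A \<tau>" by auto
    have "J \<union> Z \<in> indeps M"
    proof (rule indep_Un_of_basis[OF basis_of_A[OF \<tau>]])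
      show "(B \<inter> A \<tau>) \<union> Z \<in> indeps M"
        by (rule indeps_down_closed[OF B_indep]) (use z in auto)
    qed (use z in auto)
    moreover have "J \<union> Z \<subseteq> B \<union> \<tau>" using z A_subset[OF \<tau>] by auto
    moreover have "\<forall>j\<in>\<tau>. series \<tau> j \<subseteq> J \<union> Z" using z by (auto simp: series_def)
    ultimately show ?case using z by simp
  next
    case (3 I)
    then show ?case by auto
  next
    case (4 I)
    then have I: "I \<in> indeps M" "I \<subseteq> B \<union> \<tau>" "U \<tau> \<subseteq> I"
      using U_eq_UN_series[OF \<tau>] by auto
    then have "I \<inter> A \<tau> \<in> indeps M" using indeps_down_closed by blast
    then show ?case using I U_subset_A[OF \<tau>] subset_A[OF \<tau>] by auto
  next
    case (5 z)
    then obtain J Z where z: "z = (J, Z)" "J \<in> ?J" "Z \<subseteq> B - A \<tau>" by auto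
    then have fin: "finite J" "finite Z"
      using finite_indep finite_subset[of Z B] finite_B by auto
    have "card J \<le> ?r" using z by (intro basis_of_card_le[OF basis_of_A[OF \<tau>]]) auto
    moreover have "card Z \<le> card (B - A \<tau>)" using z finite_B by (intro card_mono) auto
    ultimately have "bern (card B) (card J + card Z) =
        bern ?r (card J) * bern (card (B - A \<tau>)) (card Z)"
      unfolding B_split[symmetric] by (rule bern_mult)
    moreover have "card (J \<union> Z) = card J + card Z" using z fin by (intro card_Un_disjoint) auto
    ultimately show ?case using z by simp
  qed
  finally show ?thesis by simp
qed

lemma ind_sum_live:
  assumes \<tau>: "\<tau> \<subseteq> R" and live: "U \<tau> \<notin> indeps M"
  shows "ind_sum \<tau> \<tau> {} = 0"
proof -
  have "\<not> (I \<in> indeps M \<and> I \<subseteq> B \<union> \<tau> \<and> (\<forall>j\<in>\<tau>. series \<tau> j \<subseteq> I) \<and> {} \<inter> I = {})" for I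
    using live indeps_down_closed[of I "U \<tau>"] U_eq_UN_series[OF \<tau>] by auto
  then show ?thesis unfolding ind_sum_def by (intro sum.neutral) blast
qed

section \<open>Extension polynomials\<close>

lemma stable_cong:
  assumes "\<And>i. i \<in> R - \<tau> \<Longrightarrow> a i = c i"
  shows "stable a \<tau> \<longleftrightarrow> stable c \<tau>"
proof -
  have "(\<exists>i\<in>\<sigma> - \<tau>. a i < base \<sigma> i) \<longleftrightarrow> (\<exists>i\<in>\<sigma> - \<tau>. c i < base \<sigma> i)" if "\<sigma> \<subseteq> R" for \<sigma>
    using that assms by (intro bex_cong) auto
  then show ?thesis unfolding stable_def by blast
qed

text \<open>On \<open>\<tau>\<close> the vector equals \<open>base \<tau>\<close>, which meets the lower thresholds of every larger \<open>\<sigma>\<close>.\<close>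

lemma Ext_eq:
  assumes "\<tau> \<subseteq> R"
  shows "Ext M B \<tau> = {c \<in> (R - \<tau>) \<rightarrow>\<^sub>E UNIV. stable c \<tau>}"
proof -
  have "can_be_fired M B \<sigma> (\<lambda>i. if i \<in> \<tau> then base \<tau> i else c i) \<longleftrightarrow>
      \<not> (\<exists>i\<in>\<sigma> - \<tau>. c i < base \<sigma> i)" if "\<tau> \<subset> \<sigma>" "\<sigma> \<subseteq> R" for \<sigma> c
    using antitone[of \<tau> \<sigma>] that by (auto simp: can_be_fired_def not_less)
  moreover have "stratum M B \<sigma> \<and> \<tau> \<subset> \<sigma> \<longleftrightarrow> \<tau> \<subset> \<sigma> \<and> \<sigma> \<subseteq> R" for \<sigma>
    by (auto simp: stratum_def)
  ultimately have "(\<not> (\<exists>\<sigma>. stratum M B \<sigma> \<and> \<tau> \<subset> \<sigma> \<and>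
      can_be_fired M B \<sigma> (\<lambda>i. if i \<in> \<tau> then base \<tau> i else c i))) \<longleftrightarrow> stable c \<tau>" for c
    unfolding stable_def by (metis (no_types, lifting))
  then show ?thesis unfolding Ext_def by simp
qed

text \<open>The vectors enumerated by \<open>(\<Prod>i\<in>\<tau>-\<rho>. [b\<^sub>\<tau>(i)]) E\<^sub>\<tau>(t)\<close>: the factor \<open>[b\<^sub>\<tau>(i)]\<close> enumerates the values
  below \<open>b\<^sub>\<tau>(i)\<close>, and \<open>E\<^sub>\<tau>\<close> the coordinates outside \<open>\<tau>\<close>.\<close>

definition below_stable :: "'a set \<Rightarrow> 'a set \<Rightarrow> ('a \<Rightarrow> nat) set" where
  "below_stable \<rho> \<tau> =
     {a \<in> (R - \<rho>) \<rightarrow>\<^sub>E UNIV. stable a \<tau> \<and> (\<forall>i\<in>\<tau> - \<rho>. a i < base \<tau> i)}"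

lemma bij_below_stable:
  assumes \<tau>: "\<tau> \<subseteq> R" and \<rho>: "\<rho> \<subseteq> \<tau>"
  shows "bij_betw (\<lambda>(g, c) i. if i \<in> \<tau> - \<rho> then g i else c i)
    ((\<Pi>\<^sub>E i\<in>\<tau> - \<rho>. {..<base \<tau> i}) \<times> Ext M B \<tau>) (below_stable \<rho> \<tau>)"
proof (rule bij_betw_byWitness[of _ "\<lambda>a. (restrict a (\<tau> - \<rho>), restrict a (R - \<tau>))"], goal_cases)
  case 1
  show ?case
  proof
    fix z assume "z \<in> (\<Pi>\<^sub>E i\<in>\<tau> - \<rho>. {..<base \<tau> i}) \<times> Ext M B \<tau>"
    then obtain g c where z: "z = (g, c)" "g \<in> extensional (\<tau> - \<rho>)" "c \<in> extensional (R - \<tau>)"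
      by (auto simp: Ext_eq[OF \<tau>] PiE_iff)
    then show "(\<lambda>a. (restrict a (\<tau> - \<rho>), restrict a (R - \<tau>)))
        ((\<lambda>(g, c) i. if i \<in> \<tau> - \<rho> then g i else c i) z) = z"
      by (auto simp: extensional_def fun_eq_iff restrict_def)
  qed
next
  case 2
  show ?case
  proof
    fix a assume "a \<in> below_stable \<rho> \<tau>"
    then have "a \<in> extensional (R - \<rho>)" by (auto simp: below_stable_def PiE_iff)
    then show "(\<lambda>(g, c) i. if i \<in> \<tau> - \<rho> then g i else c i)
        (restrict a (\<tau> - \<rho>), restrict a (R - \<tau>)) = a"
      using \<tau> \<rho> by (auto simp: extensional_def fun_eq_iff restrict_def)
  qed
next
  case 3
  show ?case
  proof
    fix a assume "a \<in> (\<lambda>(g, c) i. if i \<in> \<tau> - \<rho> then g i else c i) `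
      ((\<Pi>\<^sub>E i\<in>\<tau> - \<rho>. {..<base \<tau> i}) \<times> Ext M B \<tau>)"
    then obtain g c where a: "a = (\<lambda>i. if i \<in> \<tau> - \<rho> then g i else c i)"
      and g: "\<And>i. i \<in> \<tau> - \<rho> \<Longrightarrow> g i < base \<tau> i" and c: "c \<in> extensional (R - \<tau>)" "stable c \<tau>"
      by (auto simp: Ext_eq[OF \<tau>] PiE_iff)
    have "stable a \<tau>" using c(2) stable_cong[of \<tau> a c] by (simp add: a)
    moreover have "a \<in> extensional (R - \<rho>)" using c(1) \<tau> \<rho> by (auto simp: a extensional_def)
    ultimately show "a \<in> below_stable \<rho> \<tau>" using g by (simp add: below_stable_def PiE_iff a)
  qed
next
  case 4
  show ?case
  proof
    fix z assume "z \<in> (\<lambda>a. (restrict a (\<tau> - \<rho>), restrict a (R - \<tau>))) ` below_stable \<rho> \<tau>"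
    then obtain a where z: "z = (restrict a (\<tau> - \<rho>), restrict a (R - \<tau>))"
      and a: "stable a \<tau>" "\<And>i. i \<in> \<tau> - \<rho> \<Longrightarrow> a i < base \<tau> i" by (auto simp: below_stable_def)
    have "stable (restrict a (R - \<tau>)) \<tau>"
      using a(1) stable_cong[of \<tau> "restrict a (R - \<tau>)" a] by simp
    then show "z \<in> (\<Pi>\<^sub>E i\<in>\<tau> - \<rho>. {..<base \<tau> i}) \<times> Ext M B \<tau>"
      using a(2) by (simp add: z Ext_eq[OF \<tau>])
  qed
qed

lemma qint_times_ext_poly:
  assumes \<tau>: "\<tau> \<subseteq> R" and \<rho>: "\<rho> \<subseteq> \<tau>"
  shows "(\<Prod>i\<in>\<tau> - \<rho>. qint (base \<tau> i)) * ext_poly M B \<tau> =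
    (\<Sum>a\<in>below_stable \<rho> \<tau>. monom 1 (\<Sum>i\<in>R - \<rho>. a i))"
proof -
  let ?P = "\<Pi>\<^sub>E i\<in>\<tau> - \<rho>. {..<base \<tau> i}" and ?m = "\<lambda>(g, c) i. if i \<in> \<tau> - \<rho> then g i else c i"
  have fin: "finite (\<tau> - \<rho>)" using finite_subset_R[OF \<tau>] by simp
  have monom_sum': "(\<Prod>i\<in>X. monom 1 (g i)) = (monom 1 (\<Sum>i\<in>X. g i) :: int poly)"
    if "finite X" for X and g :: "'a \<Rightarrow> nat"
    using that by (induction X) (simp_all add: mult_monom)
  have "(\<Prod>i\<in>\<tau> - \<rho>. qint (base \<tau> i)) = (\<Sum>g\<in>?P. monom 1 (\<Sum>i\<in>\<tau> - \<rho>. g i))"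
    unfolding qint_def using fin by (subst prod_sum_PiE) (simp_all add: monom_sum')
  then have "(\<Prod>i\<in>\<tau> - \<rho>. qint (base \<tau> i)) * ext_poly M B \<tau> =
      (\<Sum>(g, c)\<in>?P \<times> Ext M B \<tau>. monom 1 ((\<Sum>i\<in>\<tau> - \<rho>. g i) + (\<Sum>i\<in>R - \<tau>. c i)))"
    unfolding ext_poly_def by (simp add: sum_product sum.cartesian_product mult_monom)
  also have "\<dots> = (\<Sum>z\<in>?P \<times> Ext M B \<tau>. monom 1 (\<Sum>i\<in>R - \<rho>. ?m z i))"
  proof (rule sum.cong[OF refl])
    fix z assume "z \<in> ?P \<times> Ext M B \<tau>"
    obtain g c where z: "z = (g, c)" by (cases z)
    have split: "R - \<rho> = (\<tau> - \<rho>) \<union> (R - \<tau>)" using \<tau> \<rho> by auto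
    have "(\<Sum>i\<in>R - \<rho>. ?m (g, c) i) = (\<Sum>i\<in>\<tau> - \<rho>. ?m (g, c) i) + (\<Sum>i\<in>R - \<tau>. ?m (g, c) i)"
      unfolding split using fin finite_R by (intro sum.union_disjoint) auto
    also have "\<dots> = (\<Sum>i\<in>\<tau> - \<rho>. g i) + (\<Sum>i\<in>R - \<tau>. c i)"
      by (intro arg_cong2[of _ _ _ _ "(+)"] sum.cong) auto
    finally show "(case z of (g, c) \<Rightarrow> monom 1 ((\<Sum>i\<in>\<tau> - \<rho>. g i) + (\<Sum>i\<in>R - \<tau>. c i))) =
        (monom 1 (\<Sum>i\<in>R - \<rho>. ?m z i) :: int poly)" by (simp only: z prod.case)
  qed
  also have "\<dots> = (\<Sum>a\<in>below_stable \<rho> \<tau>. monom 1 (\<Sum>i\<in>R - \<rho>. a i))"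
    by (rule sum.reindex_bij_betw[OF bij_below_stable[OF \<tau> \<rho>]])
  finally show ?thesis .
qed

text \<open>Each vector \<open>a\<close> contributes \<open>t\<^bsup>|a|\<^esup>\<close> times the signed count of \<open>sum_sign_stable\<close>.\<close>

lemma ext_poly_cancel:
  assumes "\<rho> \<subset> R"
  shows "(\<Sum>\<tau> | \<rho> \<subseteq> \<tau> \<and> \<tau> \<subseteq> R.
    (-1) ^ card \<tau> * ((\<Prod>i\<in>\<tau> - \<rho>. qint (base \<tau> i)) * ext_poly M B \<tau>)) = 0"
proof -
  let ?T = "{\<tau>. \<rho> \<subseteq> \<tau> \<and> \<tau> \<subseteq> R}"
  let ?V = "\<Union>\<tau>\<in>?T. below_stable \<rho> \<tau>"
  let ?m = "\<lambda>a. monom 1 (\<Sum>i\<in>R - \<rho>. a i) :: int poly"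
  have finT: "finite ?T" using finite_R by (auto intro: finite_subset[of _ "Pow R"])
  have fin_below: "finite (below_stable \<rho> \<tau>)" if "\<tau> \<in> ?T" for \<tau>
  proof -
    have "\<tau> \<subseteq> R" "\<rho> \<subseteq> \<tau>" using that by auto
    moreover have "finite ((\<Pi>\<^sub>E i\<in>\<tau> - \<rho>. {..<base \<tau> i}) \<times> Ext M B \<tau>)"
      using finite_Ext[of \<tau> B] finite_subset_R[of \<tau>] \<open>\<tau> \<subseteq> R\<close> by (intro finite_cartesian_product finite_PiE) auto
    ultimately show ?thesis using bij_below_stable bij_betw_finite by blast
  qed
  then have finV: "finite ?V" using finT by blast
  have "(\<Sum>\<tau>\<in>?T. (-1) ^ card \<tau> * ((\<Prod>i\<in>\<tau> - \<rho>. qint (base \<tau> i)) * ext_poly M B \<tau>)) =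
      (\<Sum>\<tau>\<in>?T. \<Sum>a\<in>?V. if a \<in> below_stable \<rho> \<tau> then (-1) ^ card \<tau> * ?m a else 0)"
  proof (rule sum.cong[OF refl])
    fix \<tau> assume \<tau>: "\<tau> \<in> ?T"
    then have "?V \<inter> below_stable \<rho> \<tau> = below_stable \<rho> \<tau>" by blast
    then have "(\<Sum>a\<in>?V. if a \<in> below_stable \<rho> \<tau> then (-1) ^ card \<tau> * ?m a else 0) =
        (\<Sum>a\<in>below_stable \<rho> \<tau>. (-1) ^ card \<tau> * ?m a)"
      by (simp only: sum.inter_restrict[OF finV, symmetric])
    then show "(-1) ^ card \<tau> * ((\<Prod>i\<in>\<tau> - \<rho>. qint (base \<tau> i)) * ext_poly M B \<tau>) =
        (\<Sum>a\<in>?V. if a \<in> below_stable \<rho> \<tau> then (-1) ^ card \<tau> * ?m a else 0)"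
      using \<tau> by (simp add: qint_times_ext_poly sum_distrib_left)
  qed
  also have "\<dots> = (\<Sum>a\<in>?V. \<Sum>\<tau>\<in>?T. if a \<in> below_stable \<rho> \<tau> then (-1) ^ card \<tau> * ?m a else 0)"
    by (rule sum.swap)
  also have "\<dots> = 0"
  proof (rule sum.neutral, rule ballI)
    fix a assume a: "a \<in> ?V"
    have set: "{\<tau> \<in> ?T. a \<in> below_stable \<rho> \<tau>} =
        {\<tau>. \<rho> \<subseteq> \<tau> \<and> \<tau> \<subseteq> R \<and> stable a \<tau> \<and> (\<forall>i\<in>\<tau> - \<rho>. a i < base \<tau> i)}"
      using a unfolding below_stable_def by auto
    have "(\<Sum>\<tau>\<in>?T. if a \<in> below_stable \<rho> \<tau> then (-1) ^ card \<tau> * ?m a else 0) =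
        (\<Sum>\<tau> \<in> {\<tau> \<in> ?T. a \<in> below_stable \<rho> \<tau>}. (-1) ^ card \<tau>) * ?m a"
      by (simp only: sum.inter_filter[OF finT, symmetric] sum_distrib_right)
    also have "\<dots> = of_int (\<Sum>\<tau> | \<rho> \<subseteq> \<tau> \<and> \<tau> \<subseteq> R \<and> stable a \<tau> \<and> (\<forall>i\<in>\<tau> - \<rho>. a i < base \<tau> i).
        (-1) ^ card \<tau>) * ?m a"
      unfolding set by simp
    also have "\<dots> = 0" unfolding sum_sign_stable[OF assms] by simp
    finally show "(\<Sum>\<tau>\<in>?T. if a \<in> below_stable \<rho> \<tau> then (-1) ^ card \<tau> * ?m a else 0) = 0" .
  qed
  finally show ?thesis .
qed

lemma ext_poly_R: "ext_poly M B R = 1"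
proof -
  have "stable c R" for c unfolding stable_def by auto
  then show ?thesis unfolding ext_poly_def Ext_eq[OF order_refl] by simp
qed

section \<open>The sum over dead strata\<close>

lemma h_poly_eq_sum_strata:
  "h_poly M = (\<Sum>\<tau>\<in>insert {} {\<tau>. dead_stratum M B \<tau>}.
     monom 1 (baseline_size M B \<tau>) * h_poly (dead_node M B \<tau>) * ext_poly M B \<tau>)"
proof -
  let ?q = "\<lambda>\<tau> \<rho>. \<Prod>i\<in>\<tau> - \<rho>. qint (base \<tau> i)"
  have dead: "insert {} {\<tau>. dead_stratum M B \<tau>} = {\<tau> \<in> Pow R. U \<tau> \<in> indeps M}"
    using empty_indep by (auto simp: dead_stratum_def stratum_def U_set_empty)
  have "(\<Sum>\<tau>\<in>insert {} {\<tau>. dead_stratum M B \<tau>}.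
      monom 1 (baseline_size M B \<tau>) * h_poly (dead_node M B \<tau>) * ext_poly M B \<tau>) =
      (\<Sum>\<tau>\<in>Pow R. ind_sum \<tau> \<tau> {} * ext_poly M B \<tau>)"
    \<comment> \<open>live strata may be added, since their restricted sum is empty\<close>
    unfolding dead using finite_R
    by (intro sum.mono_neutral_cong_left) (auto simp: ind_sum_dead ind_sum_live baseline_size_eq_card_U)
  also have "\<dots> = (\<Sum>\<tau>\<in>Pow R. \<Sum>\<rho>\<in>{\<rho> \<in> Pow R. \<rho> \<subseteq> \<tau>}.
      (-1) ^ card \<rho> * del_sum \<rho> * ((-1) ^ card \<tau> * (?q \<tau> \<rho> * ext_poly M B \<tau>)))"
  proof (rule sum.cong[OF refl])
    fix \<tau> assume \<tau>: "\<tau> \<in> Pow R"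
    then have Pow: "{\<rho> \<in> Pow R. \<rho> \<subseteq> \<tau>} = Pow \<tau>" by auto
    have sign: "(-1) ^ card (\<tau> - \<rho>) = ((-1) ^ card \<rho> * (-1) ^ card \<tau> :: int poly)" if "\<rho> \<subseteq> \<tau>" for \<rho>
    proof -
      have "finite \<tau>" using \<tau> by (intro finite_subset_R) simp
      then have "card \<tau> = card (\<tau> - \<rho>) + card \<rho>"
        using that by (metis card_Diff_subset card_mono finite_subset le_add_diff_inverse2)
      then show ?thesis by (simp add: power_add flip: power_mult_distrib)
    qed
    show "ind_sum \<tau> \<tau> {} * ext_poly M B \<tau> = (\<Sum>\<rho>\<in>{\<rho> \<in> Pow R. \<rho> \<subseteq> \<tau>}.
        (-1) ^ card \<rho> * del_sum \<rho> * ((-1) ^ card \<tau> * (?q \<tau> \<rho> * ext_poly M B \<tau>)))"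
      unfolding Pow node_expand[OF PowD[OF \<tau>]] sum_distrib_right
      by (intro sum.cong refl) (simp add: sign mult_ac)
  qed
  also have "\<dots> = (\<Sum>\<rho>\<in>Pow R. \<Sum>\<tau>\<in>{\<tau> \<in> Pow R. \<rho> \<subseteq> \<tau>}.
      (-1) ^ card \<rho> * del_sum \<rho> * ((-1) ^ card \<tau> * (?q \<tau> \<rho> * ext_poly M B \<tau>)))"
    using finite_R by (intro sum.swap_restrict) auto
  also have "\<dots> = (\<Sum>\<rho>\<in>Pow R. if \<rho> = R then del_sum R else 0)"
  proof (rule sum.cong[OF refl])
    fix \<rho> assume \<rho>: "\<rho> \<in> Pow R"
    have T: "{\<tau> \<in> Pow R. \<rho> \<subseteq> \<tau>} = {\<tau>. \<rho> \<subseteq> \<tau> \<and> \<tau> \<subseteq> R}" by auto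
    show "(\<Sum>\<tau>\<in>{\<tau> \<in> Pow R. \<rho> \<subseteq> \<tau>}.
        (-1) ^ card \<rho> * del_sum \<rho> * ((-1) ^ card \<tau> * (?q \<tau> \<rho> * ext_poly M B \<tau>))) =
        (if \<rho> = R then del_sum R else 0)"
    proof (cases "\<rho> = R")
      case True
      have "{\<tau> \<in> Pow R. R \<subseteq> \<tau>} = {R}" by auto
      moreover have "(-1) ^ card R * (-1) ^ card R = (1 :: int poly)"
        by (simp flip: power_mult_distrib)
      then have "(-1) ^ card R * del_sum R * ((-1) ^ card R * (1 * 1)) = del_sum R"
        by (simp only: mult_ac mult_1_right mult_1_left)
      ultimately show ?thesis unfolding True by (simp add: ext_poly_R)
    next
      case False
      then have "\<rho> \<subset> R" using \<rho> by auto
      then show ?thesis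
        unfolding T sum_distrib_left[symmetric] ext_poly_cancel[OF \<open>\<rho> \<subset> R\<close>] by simp
    qed
  qed
  also have "\<dots> = h_poly M" using finite_R by (simp add: h_poly_eq_del_sum)
  finally show ?thesis by simp
qed

end

theorem theorem4p22:
  fixes M :: "'a set_system" and B\<^sub>0 :: "'a set"
  assumes "matroid M" and "basis M B\<^sub>0"
  shows "h_poly M =
    (\<Sum>\<tau> \<in> insert {} {\<tau>. dead_stratum M B\<^sub>0 \<tau>}.
       monom 1 (baseline_size M B\<^sub>0 \<tau>) * h_poly (dead_node M B\<^sub>0 \<tau>) * ext_poly M B\<^sub>0 \<tau>)"
proof -
  interpret based_matroid M B\<^sub>0
    using assms by (intro based_matroid.intro based_matroid_axioms.intro)
  show ?thesis by (rule h_poly_eq_sum_strata)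
qed

end
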